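(* Let $\Gamma$ be a countable group acting on a Polish space $X$ in a continuous free way. Let $H$ be an invariant open graph on $X$, and let $G$ be the intersection of $H$ with the orbit equivalence relation. Let $I$ be the $\sigma$-ideal on $X$ $\sigma$-generated by Borel $G$-anticliques. For every analytic set $A\subset X$, exactly one of the following occurs: (1) $A\in I$; (2) there is a continuous injection $f\colon 2^\omega\to A$ which is a reduction of the Vitali graph to $G$.
   Context: A graph is a symmetric irreflexive binary relation; it is open if it is open as a subset of $X\times X$, and invariant if $\langle x,y\rangle\in H$ implies $\langle\gamma\cdot x,\gamma\cdot y\rangle\in H$ for every $\gamma\in\Gamma$. A $G$-anticlique is a set containing no two $G$-connected points. The Vitali graph is the graph on $2^\omega$ connecting distinct points $x,y$ just in case they disagree on only finitely many entries. A map $f$ is a reduction of a graph $S$ to a graph $G$ if for all $x,y$ in its domain, $\langle x,y\rangle\in S$ if and only if $\langle f(x),f(y)\rangle\in G$. *)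

theory Defs
  imports "HOL-Analysis.Analysis" "HOL-Algebra.Group_Action"
begin

section \<open>Polish spaces, Borel and analytic sets\<close>

text \<open>
  Spaces are carried by abstract topologies, so that no metric is fixed and the underlying set
  may be a proper (possibly empty) subset of its type.
\<close>

definition polish_space_top :: "'a topology \<Rightarrow> bool" where
  "polish_space_top X \<longleftrightarrow> completely_metrizable_space X \<and> separable_space X"

definition borel_sets_of :: "'a topology \<Rightarrow> 'a set set" where
  "borel_sets_of X = sigma_sets (topspace X) {U. openin X U}"

text \<open>
  Both \<^typ>\<open>nat \<Rightarrow> nat\<close> (the Baire space) and \<^typ>\<open>nat \<Rightarrow> bool\<close> (the Cantor space) carry
  the product topology of discrete factors as their type class topology, which is what
  \<^term>\<open>euclidean\<close> denotes at these types.
\<close>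

definition analytic_in :: "'a topology \<Rightarrow> 'a set \<Rightarrow> bool" where
  "analytic_in X A \<longleftrightarrow>
     A = {} \<or>
     (\<exists>f. continuous_map (euclidean :: (nat \<Rightarrow> nat) topology) X f \<and> A = range f)"

section \<open>\<open>\<sigma>\<close>-ideals\<close>

definition sigma_ideal :: "'a set \<Rightarrow> 'a set set \<Rightarrow> bool" where
  "sigma_ideal S I \<longleftrightarrow>
     I \<subseteq> Pow S \<and>
     {} \<in> I \<and>
     (\<forall>A\<in>I. \<forall>B. B \<subseteq> A \<longrightarrow> B \<in> I) \<and>
     (\<forall>A :: nat \<Rightarrow> 'a set. range A \<subseteq> I \<longrightarrow> (\<Union>n. A n) \<in> I)"

definition sigma_ideal_generated :: "'a set \<Rightarrow> 'a set set \<Rightarrow> 'a set set" where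
  "sigma_ideal_generated S \<B> = \<Inter>{I. sigma_ideal S I \<and> \<B> \<subseteq> I}"

text \<open>A \<open>\<sigma>\<close>-ideal may be improper, so for subsets of \<open>S\<close> the intersection above is never vacuous
  and consists of the sets covered by countably many generators.\<close>

lemma sigma_ideal_generated_iff:
  assumes "\<B> \<subseteq> Pow S"
  shows "A \<in> sigma_ideal_generated S \<B> \<longleftrightarrow> (\<exists>\<C>. countable \<C> \<and> \<C> \<subseteq> \<B> \<and> A \<subseteq> \<Union>\<C>)"
proof
  let ?J = "{A. \<exists>\<C>. countable \<C> \<and> \<C> \<subseteq> \<B> \<and> A \<subseteq> \<Union>\<C>}"
  assume A: "A \<in> sigma_ideal_generated S \<B>"
  have "(\<Union>n. F n) \<in> ?J" if F: "range F \<subseteq> ?J" for F :: "nat \<Rightarrow> 'a set"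
  proof -
    have "\<forall>n. \<exists>\<C>. countable \<C> \<and> \<C> \<subseteq> \<B> \<and> F n \<subseteq> \<Union>\<C>"
      using F by (simp add: image_subset_iff)
    then obtain C where C: "\<And>n. countable (C n) \<and> C n \<subseteq> \<B> \<and> F n \<subseteq> \<Union>(C n)"
      by metis
    have "countable (\<Union>n. C n)"
      using C by simp
    moreover have "(\<Union>n. C n) \<subseteq> \<B>"
      using C by (simp add: UN_subset_iff)
    moreover have "(\<Union>n. F n) \<subseteq> \<Union>(\<Union>n. C n)"
    proof
      fix x assume "x \<in> (\<Union>n. F n)"
      then obtain n where "x \<in> F n" by auto
      then have "x \<in> \<Union>(C n)" using C[of n] by auto
      then show "x \<in> \<Union>(\<Union>n. C n)" by auto
    qed
    ultimately show ?thesis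
      unfolding mem_Collect_eq by (intro exI[of _ "\<Union>n. C n"] conjI)
  qed
  moreover have "?J \<subseteq> Pow S"
  proof
    fix B assume "B \<in> ?J"
    then obtain \<C> where "\<C> \<subseteq> \<B>" "B \<subseteq> \<Union>\<C>"
      by auto
    moreover have "\<Union>\<C> \<subseteq> S"
      using assms \<open>\<C> \<subseteq> \<B>\<close> by blast
    ultimately show "B \<in> Pow S"
      by simp
  qed
  moreover have "{} \<in> ?J"
    unfolding mem_Collect_eq by (intro exI[of _ "{}"]) simp
  moreover have "\<forall>A\<in>?J. \<forall>B. B \<subseteq> A \<longrightarrow> B \<in> ?J"
    unfolding mem_Collect_eq Ball_def by (meson subset_trans)
  ultimately have "sigma_ideal S ?J"
    unfolding sigma_ideal_def by simp
  moreover have "\<B> \<subseteq> ?J"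
  proof
    fix B assume "B \<in> \<B>"
    then have "countable {B} \<and> {B} \<subseteq> \<B> \<and> B \<subseteq> \<Union>{B}"
      by simp
    then show "B \<in> ?J"
      unfolding mem_Collect_eq by (rule exI)
  qed
  ultimately have "?J \<in> {I. sigma_ideal S I \<and> \<B> \<subseteq> I}"
    by (intro CollectI conjI)
  then have "A \<in> ?J"
    using A unfolding sigma_ideal_generated_def by (rule InterD[rotated])
  then show "\<exists>\<C>. countable \<C> \<and> \<C> \<subseteq> \<B> \<and> A \<subseteq> \<Union>\<C>"
    by simp
next
  assume "\<exists>\<C>. countable \<C> \<and> \<C> \<subseteq> \<B> \<and> A \<subseteq> \<Union>\<C>"
  then obtain \<C> where C: "countable \<C>" "\<C> \<subseteq> \<B>" "A \<subseteq> \<Union>\<C>"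
    by blast
  have "A \<in> I" if I: "sigma_ideal S I" "\<B> \<subseteq> I" for I
  proof (cases "\<C> = {}")
    case True
    then show ?thesis
      using C I by (simp add: sigma_ideal_def)
  next
    case False
    then have r: "range (from_nat_into \<C>) = \<C>"
      using C by (simp add: range_from_nat_into)
    then have "range (from_nat_into \<C>) \<subseteq> I"
      using C I by simp
    then have "\<Union>(range (from_nat_into \<C>)) \<in> I"
      using I(1) unfolding sigma_ideal_def by (elim conjE allE[of _ "from_nat_into \<C>"]) simp
    then have "\<Union>\<C> \<in> I"
      by (simp add: r)
    then show ?thesis
      using C I unfolding sigma_ideal_def by simp
  qed
  then show "A \<in> sigma_ideal_generated S \<B>"
    unfolding sigma_ideal_generated_def by simp
qed

section \<open>Graphs\<close>

definition graph_on :: "'a set \<Rightarrow> ('a \<times> 'a) set \<Rightarrow> bool" where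
  "graph_on S E \<longleftrightarrow> E \<subseteq> S \<times> S \<and> sym E \<and> irrefl E"

definition anticlique :: "'a set \<Rightarrow> ('a \<times> 'a) set \<Rightarrow> 'a set \<Rightarrow> bool" where
  "anticlique S E B \<longleftrightarrow> B \<subseteq> S \<and> (\<forall>x\<in>B. \<forall>y\<in>B. (x, y) \<notin> E)"

definition vitali_graph :: "((nat \<Rightarrow> bool) \<times> (nat \<Rightarrow> bool)) set" where
  "vitali_graph = {(x, y). x \<noteq> y \<and> finite {n. x n \<noteq> y n}}"

definition reduction_on :: "'a set \<Rightarrow> ('a \<times> 'a) set \<Rightarrow> ('b \<times> 'b) set \<Rightarrow> ('a \<Rightarrow> 'b) \<Rightarrow> bool" where
  "reduction_on D S G f \<longleftrightarrow> (\<forall>x\<in>D. \<forall>y\<in>D. (x, y) \<in> S \<longleftrightarrow> (f x, f y) \<in> G)"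

section \<open>Group actions\<close>

text \<open>The countable acting group carries the discrete topology.\<close>

definition continuous_action ::
    "('g, 'm) monoid_scheme \<Rightarrow> 'a topology \<Rightarrow> ('g \<Rightarrow> 'a \<Rightarrow> 'a) \<Rightarrow> bool" where
  "continuous_action \<Gamma> X \<phi> \<longleftrightarrow>
     group_action \<Gamma> (topspace X) \<phi> \<and>
     continuous_map (prod_topology (discrete_topology (carrier \<Gamma>)) X) X (\<lambda>(g, x). \<phi> g x)"

definition free_action ::
    "('g, 'm) monoid_scheme \<Rightarrow> 'a set \<Rightarrow> ('g \<Rightarrow> 'a \<Rightarrow> 'a) \<Rightarrow> bool" where
  "free_action \<Gamma> S \<phi> \<longleftrightarrow>
     (\<forall>g\<in>carrier \<Gamma>. \<forall>x\<in>S. \<phi> g x = x \<longrightarrow> g = \<one>\<^bsub>\<Gamma>\<^esub>)"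

definition invariant_rel ::
    "('g, 'm) monoid_scheme \<Rightarrow> ('g \<Rightarrow> 'a \<Rightarrow> 'a) \<Rightarrow> ('a \<times> 'a) set \<Rightarrow> bool" where
  "invariant_rel \<Gamma> \<phi> H \<longleftrightarrow>
     (\<forall>g\<in>carrier \<Gamma>. \<forall>(x, y)\<in>H. (\<phi> g x, \<phi> g y) \<in> H)"

definition orbit_equivalence ::
    "('g, 'm) monoid_scheme \<Rightarrow> 'a set \<Rightarrow> ('g \<Rightarrow> 'a \<Rightarrow> 'a) \<Rightarrow> ('a \<times> 'a) set" where
  "orbit_equivalence \<Gamma> S \<phi> = {(x, y). x \<in> S \<and> y \<in> orbit \<Gamma> \<phi> x}"

end

(*
A is written as the image of the Baire space under a continuous map p. If A is not in I, the map f is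
obtained by fusion: a decreasing sequence of analytic sets W n outside I and group elements g n are
chosen so that W (n+1) and its translate by g n both lie in W n, and so that distinct products of
the g i with i < n, evaluated on a closed set K n containing W n, are H-adjacent. Points with the same tail
are then sent to translates of one point of K n. The choice of g n is possible
because an analytic anticlique is contained in a Borel one by Lusin separation, whence every analytic W outside
I has some g for which the set of x in W with g x in W and H-adjacent to x is outside I. Avoiding a finite
set of g at each step keeps the images of Vitali-inequivalent points in different orbits. The values of f
lie in A because the construction also fixes longer and longer initial segments of p-preimages.

Conversely, the preimages of countably many Borel anticliques cannot cover the Cantor space: one of them
would be nonmeager, hence comeager in a cylinder, hence contain two points that differ in one coordinate.
*)

theory Submission
  imports Defs
begin

section \<open>Cylinders and continuity on sequence spaces\<close>

section \<open>Sequence spaces\<close>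

text \<open>A basic open set is named by one of its points and a length, so no separate finite words
  are needed. The same notion serves the Baire space and the Cantor space.\<close>

definition cyl :: "(nat \<Rightarrow> 'b) \<Rightarrow> nat \<Rightarrow> (nat \<Rightarrow> 'b) set" where
  "cyl a n = {b. \<forall>i<n. b i = a i}"

lemma self_in_cyl [simp]: "a \<in> cyl a n"
  by (simp add: cyl_def)

lemma cyl_antimono: "m \<le> n \<Longrightarrow> cyl a n \<subseteq> cyl a m"
  by (auto simp: cyl_def)

lemma cyl_eq: "b \<in> cyl a n \<Longrightarrow> cyl b n = cyl a n"
  by (auto simp: cyl_def)

lemma cyl_0 [simp]: "cyl a 0 = UNIV"
  by (simp add: cyl_def)

lemma open_cyl: "open (cyl (a :: nat \<Rightarrow> 'b::discrete_topology) n)"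
proof -
  have "cyl a n = (\<Inter>i\<in>{..<n}. (\<lambda>b. b i) -` {a i})"
    by (auto simp: cyl_def)
  moreover have "open ((\<lambda>b :: nat \<Rightarrow> 'b. b i) -` {a i})" for i
    by (intro open_vimage open_discrete continuous_on_product_coordinates)
  ultimately show ?thesis
    by auto
qed

lemma open_iff_cyl:
  fixes W :: "(nat \<Rightarrow> 'b::discrete_topology) set"
  shows "open W \<longleftrightarrow> (\<forall>a\<in>W. \<exists>n. cyl a n \<subseteq> W)"
proof
  assume W: "open W"
  show "\<forall>a\<in>W. \<exists>n. cyl a n \<subseteq> W"
  proof
    fix a assume a: "a \<in> W"
    from W have "openin (product_topology (\<lambda>i. euclidean) UNIV) W"
      by (simp add: open_fun_def)
    from product_topology_open_contains_basis[OF this a]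
    obtain Y where Y: "a \<in> (\<Pi>\<^sub>E i\<in>UNIV. Y i)" "finite {i. Y i \<noteq> UNIV}" "(\<Pi>\<^sub>E i\<in>UNIV. Y i) \<subseteq> W"
      by auto
    obtain n where n: "\<And>i. Y i \<noteq> UNIV \<Longrightarrow> i < n"
      using Y(2) by (metis (mono_tags, lifting) finite_nat_iff_bounded lessThan_iff mem_Collect_eq subsetD)
    have "b \<in> W" if b: "b \<in> cyl a n" for b
    proof -
      have "b i \<in> Y i" for i
        using Y(1) b n[of i] by (cases "Y i = UNIV") (auto simp: cyl_def PiE_iff)
      then show ?thesis
        using Y(3) by (auto simp: PiE_iff)
    qed
    then show "\<exists>n. cyl a n \<subseteq> W"
      by blast
  qed
next
  assume *: "\<forall>a\<in>W. \<exists>n. cyl a n \<subseteq> W"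
  show "open W"
  proof (subst open_subopen, intro ballI)
    fix a assume "a \<in> W"
    then show "\<exists>T. open T \<and> a \<in> T \<and> T \<subseteq> W"
      using * open_cyl self_in_cyl by metis
  qed
qed

lemma closed_cylD:
  fixes C :: "(nat \<Rightarrow> 'b::discrete_topology) set"
  assumes "closed C" "\<And>n. C \<inter> cyl a n \<noteq> {}"
  shows "a \<in> C"
  using assms open_iff_cyl[of "- C"] by (fastforce simp: open_Compl)

lemma closed_cylI:
  fixes C :: "(nat \<Rightarrow> 'b::discrete_topology) set"
  assumes "\<And>a. (\<And>n. C \<inter> cyl a n \<noteq> {}) \<Longrightarrow> a \<in> C"
  shows "closed C"
proof -
  have "open (- C)"
    unfolding open_iff_cyl using assms by blast
  then show ?thesis
    by (simp add: closed_def)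
qed

text \<open>Cylinders form a base, so continuity can be tested on them. Maps defined by recoding
  sequences are handled through this criterion.\<close>

lemma continuous_map_iff_cyl:
  fixes C :: "(nat \<Rightarrow> 'b::discrete_topology) set"
  shows "continuous_map (top_of_set C) X p \<longleftrightarrow>
    p ` C \<subseteq> topspace X \<and> (\<forall>a\<in>C. \<forall>U. openin X U \<longrightarrow> p a \<in> U \<longrightarrow> (\<exists>n. p ` (C \<inter> cyl a n) \<subseteq> U))"
    (is "?l \<longleftrightarrow> ?r")
proof
  assume l: ?l
  have "\<exists>n. p ` (C \<inter> cyl a n) \<subseteq> U" if a: "a \<in> C" and U: "openin X U" "p a \<in> U" for a U
  proof -
    have "openin (top_of_set C) {x \<in> C. p x \<in> U}"
      using openin_continuous_map_preimage[OF l U(1)] by simp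
    then obtain T where T: "open T" "{x \<in> C. p x \<in> U} = C \<inter> T"
      by (auto simp: openin_open)
    then obtain n where "cyl a n \<subseteq> T"
      using a U open_iff_cyl by blast
    with T show ?thesis
      by blast
  qed
  then show ?r
    using continuous_map_image_subset_topspace[OF l] by auto
next
  assume r: ?r
  show ?l
    unfolding continuous_map_def
  proof (intro conjI allI impI)
    show "p \<in> topspace (top_of_set C) \<rightarrow> topspace X"
      using r by auto
    fix U assume U: "openin X U"
    show "openin (top_of_set C) {x \<in> topspace (top_of_set C). p x \<in> U}"
    proof (subst openin_subopen, intro ballI)
      fix a assume "a \<in> {x \<in> topspace (top_of_set C). p x \<in> U}"
      then have a: "a \<in> C" "p a \<in> U" by auto
      then obtain n where n: "p ` (C \<inter> cyl a n) \<subseteq> U"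
        using r U by blast
      show "\<exists>T. openin (top_of_set C) T \<and> a \<in> T \<and> T \<subseteq> {x \<in> topspace (top_of_set C). p x \<in> U}"
        using n a open_cyl[of a n] by (intro exI[of _ "C \<inter> cyl a n"]) auto
    qed
  qed
qed

lemma continuous_map_UNIV_iff_cyl:
  fixes p :: "(nat \<Rightarrow> 'b::discrete_topology) \<Rightarrow> 'a"
  shows "continuous_map euclidean X p \<longleftrightarrow>
    range p \<subseteq> topspace X \<and> (\<forall>a U. openin X U \<longrightarrow> p a \<in> U \<longrightarrow> (\<exists>n. p ` cyl a n \<subseteq> U))"
  using continuous_map_iff_cyl[of UNIV X p] by simp

text \<open>Entry \<open>i\<close> no longer changes from stage \<open>Suc i\<close> on, hence the
  diagonal limit. It yields the limit codes both in the separation theorem and in the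
  fusion.\<close>

lemma cyl_limit:
  assumes "\<And>n. a (Suc n) \<in> cyl (a n) n"
  shows "(\<lambda>i. a (Suc i) i) \<in> cyl (a n) n"
proof -
  have *: "a (Suc i + k) i = a (Suc i) i" for i k
  proof (induction k)
    case (Suc k)
    have "a (Suc (Suc i + k)) i = a (Suc i + k) i"
      using assms[of "Suc i + k"] by (simp add: cyl_def)
    then show ?case
      using Suc by simp
  qed simp
  have "a n i = a (Suc i) i" if "i < n" for i
    using *[of i "n - Suc i"] that by simp
  then show ?thesis
    by (simp add: cyl_def)
qed

section \<open>Closure properties of analytic sets\<close>

section \<open>Analytic sets\<close>

text \<open>Allowing the domain to be a closed subset of the Baire space avoids the use of retractions
  and makes the empty set no special case.\<close>

definition souslin_in :: "'a topology \<Rightarrow> 'a set \<Rightarrow> bool" where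
  "souslin_in X P \<longleftrightarrow>
     (\<exists>C p. closed (C :: (nat \<Rightarrow> nat) set) \<and> continuous_map (top_of_set C) X p \<and> P = p ` C)"

lemma souslin_in_subset: "souslin_in X P \<Longrightarrow> P \<subseteq> topspace X"
  unfolding souslin_in_def by (auto simp: continuous_map_iff_cyl)

lemma souslin_in_image:
  assumes "souslin_in X P" "continuous_map X Y f"
  shows "souslin_in Y (f ` P)"
proof -
  obtain C p where C: "closed (C :: (nat \<Rightarrow> nat) set)" "continuous_map (top_of_set C) X p" "P = p ` C"
    using assms(1) unfolding souslin_in_def by blast
  then have "continuous_map (top_of_set C) Y (f \<circ> p)" "f ` P = (f \<circ> p) ` C"
    using assms(2) continuous_map_compose by (blast, auto)
  with C show ?thesis
    unfolding souslin_in_def by blast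
qed

lemma souslin_in_Int_closedin:
  assumes "souslin_in X P" "closedin X K"
  shows "souslin_in X (P \<inter> K)"
proof -
  obtain C p where C: "closed (C :: (nat \<Rightarrow> nat) set)" "continuous_map (top_of_set C) X p" "P = p ` C"
    using assms(1) unfolding souslin_in_def by blast
  let ?D = "{x \<in> C. p x \<in> K}"
  have "closedin (top_of_set C) ?D"
    using closedin_continuous_map_preimage[OF C(2) assms(2)] by simp
  then have "closed ?D"
    using C(1) closedin_closed_trans by blast
  moreover have "continuous_map (top_of_set ?D) X p"
    using C(2) by (rule continuous_map_from_subtopology_mono) auto
  moreover have "P \<inter> K = p ` ?D"
    using C(3) by auto
  ultimately show ?thesis
    unfolding souslin_in_def by blast
qed

text \<open>The first entry of a code selects \<open>n\<close> and its tail is a code for a point of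
  \<open>P n\<close>.\<close>

lemma souslin_in_UN:
  assumes "\<And>n :: nat. souslin_in X (P n)"
  shows "souslin_in X (\<Union>n. P n)"
proof -
  have "\<exists>C p. \<forall>n. closed (C n :: (nat \<Rightarrow> nat) set) \<and> continuous_map (top_of_set (C n)) X (p n) \<and> P n = p n ` C n"
    using assms unfolding souslin_in_def by metis
  then obtain C p where C: "\<And>n. closed (C n :: (nat \<Rightarrow> nat) set)"
      "\<And>n. continuous_map (top_of_set (C n)) X (p n)" "\<And>n. P n = p n ` C n"
    by blast
  define tail where "tail c = (\<lambda>i. c (Suc i))" for c :: "nat \<Rightarrow> nat"
  have tail_cyl: "tail c \<in> cyl (tail d) n" "c 0 = d 0" if "c \<in> cyl d (Suc n)" for c d n
    using that by (auto simp: tail_def cyl_def)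
  let ?D = "{c. tail c \<in> C (c 0)}"
  let ?q = "\<lambda>c. p (c 0) (tail c)"
  have "closed ?D"
  proof (rule closed_cylI)
    fix c assume c: "\<And>n. ?D \<inter> cyl c n \<noteq> {}"
    have "C (c 0) \<inter> cyl (tail c) n \<noteq> {}" for n
    proof -
      obtain d where "d \<in> ?D" "d \<in> cyl c (Suc n)"
        using c[of "Suc n"] by blast
      then show ?thesis
        using tail_cyl[of d c n] by auto
    qed
    then show "c \<in> ?D"
      using closed_cylD[OF C(1)] by blast
  qed
  moreover have "continuous_map (top_of_set ?D) X ?q"
    unfolding continuous_map_iff_cyl
  proof (intro conjI ballI allI impI)
    show "?q ` ?D \<subseteq> topspace X"
      using C(2) by (auto simp: continuous_map_iff_cyl)
    fix c U assume c: "c \<in> ?D" and U: "openin X U" "?q c \<in> U"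
    then obtain n where n: "p (c 0) ` (C (c 0) \<inter> cyl (tail c) n) \<subseteq> U"
      using C(2)[of "c 0"] unfolding continuous_map_iff_cyl by blast
    then have "?q ` (?D \<inter> cyl c (Suc n)) \<subseteq> U"
      using tail_cyl[of _ c n] by fastforce
    then show "\<exists>n. ?q ` (?D \<inter> cyl c n) \<subseteq> U"
      by blast
  qed
  moreover have "(\<Union>n. P n) = ?q ` ?D"
  proof
    show "(\<Union>n. P n) \<subseteq> ?q ` ?D"
    proof
      fix x assume "x \<in> (\<Union>n. P n)"
      then obtain n c where c: "c \<in> C n" "x = p n c"
        using C(3) by auto
      have "tail (case_nat n c) = c"
        by (simp add: tail_def)
      then show "x \<in> ?q ` ?D"
        using c by (intro image_eqI[of _ _ "case_nat n c"]) auto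
    qed
  qed (use C(3) in auto)
  ultimately show ?thesis
    unfolding souslin_in_def by (intro exI[of _ ?D] exI[of _ ?q]) auto
qed

text \<open>A code is a sequence of codes, interleaved by \<open>prod_encode\<close>, all naming the
  same point. The Hausdorff property makes this agreement a closed condition.\<close>

lemma souslin_in_INT:
  assumes "Hausdorff_space X" "\<And>n :: nat. souslin_in X (P n)"
  shows "souslin_in X (\<Inter>n. P n)"
proof -
  have "\<exists>C p. \<forall>n. closed (C n :: (nat \<Rightarrow> nat) set) \<and> continuous_map (top_of_set (C n)) X (p n) \<and> P n = p n ` C n"
    using assms(2) unfolding souslin_in_def by metis
  then obtain C p where C: "\<And>n. closed (C n :: (nat \<Rightarrow> nat) set)"
      "\<And>n. continuous_map (top_of_set (C n)) X (p n)" "\<And>n. P n = p n ` C n"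
    by blast
  define part where "part n c = (\<lambda>i. c (prod_encode (n, i)))" for n and c :: "nat \<Rightarrow> nat"
  have part: "continuous_on UNIV (part n)" for n
    unfolding part_def by (intro continuous_on_coordinatewise_then_product continuous_on_product_coordinates)
  define D where "D = (\<Inter>n. part n -` C n)"
  have D: "closed D"
    unfolding D_def using part C(1) by (intro closed_INT ballI) (simp add: closed_vimage)
  have q: "continuous_map (top_of_set D) X (p n \<circ> part n)" for n
  proof (rule continuous_map_compose[OF _ C(2)])
    show "continuous_map (top_of_set D) (top_of_set (C n)) (part n)"
      using part[of n] by (auto simp: D_def intro: continuous_on_subset)
  qed
  define E where "E = (\<Inter>n. {c \<in> D. (p n \<circ> part n) c = (p 0 \<circ> part 0) c})"
  have "closed {c \<in> D. (p n \<circ> part n) c = (p 0 \<circ> part 0) c}" for n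
    using closedin_continuous_maps_eq[OF assms(1) q[of n] q[of 0]] D closedin_closed_trans
    by (fastforce simp: Int_def)
  then have "closed E"
    unfolding E_def by auto
  moreover have "continuous_map (top_of_set E) X (p 0 \<circ> part 0)"
    using q by (rule continuous_map_from_subtopology_mono) (auto simp: E_def)
  moreover have "(\<Inter>n. P n) = (p 0 \<circ> part 0) ` E"
  proof
    show "(\<Inter>n. P n) \<subseteq> (p 0 \<circ> part 0) ` E"
    proof
      fix x assume "x \<in> (\<Inter>n. P n)"
      then have "\<forall>n. \<exists>c. c \<in> C n \<and> x = p n c"
        using C(3) by auto
      then obtain c where c: "\<And>n. c n \<in> C n" "\<And>n. x = p n (c n)"
        by metis
      define d where "d k = (case prod_decode k of (n, i) \<Rightarrow> c n i)" for k
      have "part n d = c n" for n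
        by (simp add: part_def d_def)
      then show "x \<in> (p 0 \<circ> part 0) ` E"
        using c by (intro image_eqI[of _ _ d]) (auto simp: E_def D_def)
    qed
    show "(p 0 \<circ> part 0) ` E \<subseteq> (\<Inter>n. P n)"
    proof clarify
      fix c n assume c: "c \<in> E"
      have "(p n \<circ> part n) c = (p 0 \<circ> part 0) c"
        using c unfolding E_def by blast
      moreover have "part n c \<in> C n"
        using c unfolding E_def D_def by blast
      ultimately show "(p 0 \<circ> part 0) c \<in> P n"
        unfolding C(3) by (metis comp_apply imageI)
    qed
  qed
  ultimately show ?thesis
    unfolding souslin_in_def by blast
qed

lemma souslin_in_Int:
  assumes "Hausdorff_space X" "souslin_in X P" "souslin_in X Q"
  shows "souslin_in X (P \<inter> Q)"
proof -
  have "souslin_in X (\<Inter>n::nat. if n = 0 then P else Q)"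
    by (rule souslin_in_INT[OF assms(1)]) (use assms in auto)
  moreover have "(\<Inter>n::nat. if n = 0 then P else Q) = P \<inter> Q"
    by auto
  ultimately show ?thesis
    by simp
qed

text \<open>Complementation exchanges the two claims, so they are proved by one induction; open sets
  reduce to closed ones because they are F-sigma. Working relative to \<open>P\<close> avoids coding
  the whole space.\<close>

lemma souslin_in_Borel:
  assumes X: "metrizable_space X" and E: "E \<in> borel_sets_of X" and P: "souslin_in X P"
  shows "souslin_in X (P \<inter> E)" "souslin_in X (P - E)"
proof -
  have H: "Hausdorff_space X"
    using X by (rule metrizable_imp_Hausdorff_space)
  have "souslin_in X (P \<inter> E) \<and> souslin_in X (P - E)"
    using E P unfolding borel_sets_of_def
  proof (induction arbitrary: P rule: sigma_sets.induct)
    case (Basic U)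
    then have U: "openin X U" by simp
    have "fsigma_in X U"
      using X U open_imp_fsigma_in by blast
    then obtain K where K: "\<And>n :: nat. closedin X (K n)" "\<Union>(range K) = U"
      by (metis fsigma_in_ascending)
    have "souslin_in X (\<Union>n. P \<inter> K n)"
      using Basic K(1) by (intro souslin_in_UN souslin_in_Int_closedin)
    moreover have "P \<inter> U = (\<Union>n. P \<inter> K n)"
      using K(2) by auto
    moreover have "P - U = P \<inter> (topspace X - U)"
      using souslin_in_subset[OF Basic(2)] by auto
    ultimately show ?case
      using souslin_in_Int_closedin[OF Basic(2), of "topspace X - U"] U by (simp add: closedin_diff)
  next
    case Empty
    then show ?case
      using souslin_in_Int_closedin[of X P "{}"] by simp
  next
    case (Compl E)
    have "P \<inter> (topspace X - E) = P - E" "P - (topspace X - E) = P \<inter> E"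
      using souslin_in_subset[OF Compl.prems] by auto
    then show ?case
      using Compl by simp
  next
    case (Union E)
    have "P \<inter> (\<Union>n. E n) = (\<Union>n. P \<inter> E n)" "P - (\<Union>n. E n) = (\<Inter>n. P - E n)"
      by auto
    then show ?case
      using Union souslin_in_UN[of X "\<lambda>n. P \<inter> E n"] souslin_in_INT[OF H, of "\<lambda>n. P - E n"] by simp
  qed
  then show "souslin_in X (P \<inter> E)" "souslin_in X (P - E)"
    by auto
qed

section \<open>Borel sets and Lusin separation\<close>

lemma sigma_algebra_borel_sets_of: "sigma_algebra (topspace X) (borel_sets_of X)"
  unfolding borel_sets_of_def by (rule sigma_algebra_sigma_sets) (auto dest: openin_subset)

lemma openin_borel_sets_of: "openin X U \<Longrightarrow> U \<in> borel_sets_of X"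
  unfolding borel_sets_of_def by (auto intro: sigma_sets.Basic)

lemma vimage_borel_sets_of:
  assumes f: "continuous_map X Y f" and E: "E \<in> borel_sets_of Y"
  shows "f -` E \<inter> topspace X \<in> borel_sets_of X"
proof -
  interpret sigma_algebra "topspace X" "borel_sets_of X"
    by (rule sigma_algebra_borel_sets_of)
  show ?thesis
    using E unfolding borel_sets_of_def[of Y]
  proof (induction rule: sigma_sets.induct)
    case (Basic U)
    then have "openin X {x \<in> topspace X. f x \<in> U}"
      using openin_continuous_map_preimage[OF f] by simp
    then show ?case
      using openin_borel_sets_of by (simp add: vimage_def Int_def conj_commute)
  next
    case (Compl E)
    have "f -` (topspace Y - E) \<inter> topspace X = topspace X - (f -` E \<inter> topspace X)"
      using continuous_map_image_subset_topspace[OF f] by auto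
    then show ?case
      using Compl by auto
  next
    case (Union E)
    have "(\<Union>n. f -` E n \<inter> topspace X) \<in> borel_sets_of X"
      using Union.IH by (intro countable_UN) auto
    moreover have "f -` (\<Union>n. E n) \<inter> topspace X = (\<Union>n. f -` E n \<inter> topspace X)"
      by auto
    ultimately show ?case
      by simp
  qed auto
qed

text \<open>If separation failed, it would fail again for the images of some pair of one-step longer
  cylinders, and so on forever. The limit codes name distinct points, whose disjoint neighbourhoods
  separate the images of small enough cylinders, a contradiction.\<close>

theorem souslin_separation:
  assumes X: "Hausdorff_space X" and P: "souslin_in X P" and Q: "souslin_in X Q" and "P \<inter> Q = {}"
  shows "\<exists>B\<in>borel_sets_of X. P \<subseteq> B \<and> B \<inter> Q = {}"
proof (rule ccontr)
  interpret sigma_algebra "topspace X" "borel_sets_of X"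
    by (rule sigma_algebra_borel_sets_of)
  define sep where "sep S T \<longleftrightarrow> (\<exists>B\<in>borel_sets_of X. S \<subseteq> B \<and> B \<inter> T = {})" for S T
  \<comment> \<open>Contrapositively, a failure for two countable unions is inherited by some pair
    of pieces; this drives the descent.\<close>
  have sep_UN: "sep (\<Union>i. S i) (\<Union>j. T j)" if "\<And>i j. sep (S i) (T j)" for S T :: "nat \<Rightarrow> 'a set"
  proof -
    have "\<forall>i j. \<exists>B. B \<in> borel_sets_of X \<and> S i \<subseteq> B \<and> B \<inter> T j = {}"
      using that unfolding sep_def by blast
    then obtain B where B: "\<And>i j. B i j \<in> borel_sets_of X" "\<And>i j. S i \<subseteq> B i j"
        "\<And>i j. B i j \<inter> T j = {}"
      by metis
    have "(\<Union>i. \<Inter>j. B i j) \<in> borel_sets_of X"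
      using B(1) by (intro countable_UN countable_INT) auto
    then show ?thesis
      unfolding sep_def using B(2,3) by (intro bexI[of _ "\<Union>i. \<Inter>j. B i j"]) (auto, blast)
  qed
  obtain C p where C: "closed (C :: (nat \<Rightarrow> nat) set)" "continuous_map (top_of_set C) X p" "P = p ` C"
    using P unfolding souslin_in_def by blast
  obtain D q where D: "closed (D :: (nat \<Rightarrow> nat) set)" "continuous_map (top_of_set D) X q" "Q = q ` D"
    using Q unfolding souslin_in_def by blast
  define bad where "bad n ab \<longleftrightarrow> \<not> sep (p ` (C \<inter> cyl (fst ab) n)) (q ` (D \<inter> cyl (snd ab) n))" for n ab
  assume "\<not> (\<exists>B\<in>borel_sets_of X. P \<subseteq> B \<and> B \<inter> Q = {})"
  then have "bad 0 ab" for ab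
    using C(3) D(3) by (simp add: bad_def sep_def)
  moreover have "\<exists>ab'. bad (Suc n) ab' \<and> fst ab' \<in> cyl (fst ab) n \<and> snd ab' \<in> cyl (snd ab) n"
    if "bad n ab" for n ab
  proof -
    have split: "c ` (E \<inter> cyl a n) = (\<Union>i. c ` (E \<inter> cyl (a(n := i)) (Suc n)))"
      for c :: "(nat \<Rightarrow> nat) \<Rightarrow> 'a" and E a
    proof -
      have "cyl a n = (\<Union>i. cyl (a(n := i)) (Suc n))"
        by (auto simp: cyl_def less_Suc_eq)
      then show ?thesis
        by blast
    qed
    have "\<exists>i j. \<not> sep (p ` (C \<inter> cyl ((fst ab)(n := i)) (Suc n))) (q ` (D \<inter> cyl ((snd ab)(n := j)) (Suc n)))"
    proof (rule ccontr)
      assume "\<not> ?thesis"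
      then show False
        using sep_UN[of "\<lambda>i. p ` (C \<inter> cyl ((fst ab)(n := i)) (Suc n))"
              "\<lambda>j. q ` (D \<inter> cyl ((snd ab)(n := j)) (Suc n))"] that
        unfolding bad_def split[of p] split[of q] by blast
    qed
    then obtain i j where "bad (Suc n) ((fst ab)(n := i), (snd ab)(n := j))"
      unfolding bad_def by auto
    then show ?thesis
      by (intro exI[of _ "((fst ab)(n := i), (snd ab)(n := j))"]) (auto simp: cyl_def)
  qed
  ultimately obtain ab where bad: "\<And>n. bad n (ab n)"
      and step: "\<And>n. fst (ab (Suc n)) \<in> cyl (fst (ab n)) n \<and> snd (ab (Suc n)) \<in> cyl (snd (ab n)) n"
    using dependent_nat_choice[of bad "\<lambda>n ab ab'. fst ab' \<in> cyl (fst ab) n \<and> snd ab' \<in> cyl (snd ab) n"]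
    by blast
  define a where "a = (\<lambda>i. fst (ab (Suc i)) i)"
  define b where "b = (\<lambda>i. snd (ab (Suc i)) i)"
  have "a \<in> cyl (fst (ab n)) n" "b \<in> cyl (snd (ab n)) n" for n
    unfolding a_def b_def
    using cyl_limit[of "\<lambda>n. fst (ab n)"] cyl_limit[of "\<lambda>n. snd (ab n)"] step by auto
  then have nsep: "\<not> sep (p ` (C \<inter> cyl a n)) (q ` (D \<inter> cyl b n))" for n
    using bad[of n] cyl_eq unfolding bad_def by metis
  \<comment> \<open>The empty set is separated from every subset of the space, so neither trace is
    empty; closedness then puts the limit codes into \<open>C\<close> and \<open>D\<close>.\<close>
  have "C \<inter> cyl a n \<noteq> {}" "D \<inter> cyl b n \<noteq> {}" for n
  proof -
    have "sep {} T" for T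
      unfolding sep_def by (intro bexI[of _ "{}"]) auto
    then show "C \<inter> cyl a n \<noteq> {}"
      using nsep[of n] by auto
    have "sep S {}" if "S \<subseteq> topspace X" for S
      unfolding sep_def using that by (intro bexI[of _ "topspace X"]) auto
    moreover have "p ` (C \<inter> cyl a n) \<subseteq> topspace X"
      using C(2) by (auto simp: continuous_map_iff_cyl)
    ultimately show "D \<inter> cyl b n \<noteq> {}"
      using nsep[of n] by auto
  qed
  then have ab: "a \<in> C" "b \<in> D"
    using C(1) D(1) closed_cylD by blast+
  then have "p a \<noteq> q b" "p a \<in> topspace X" "q b \<in> topspace X"
    using \<open>P \<inter> Q = {}\<close> C D by (auto simp: continuous_map_iff_cyl)
  then obtain U V where UV: "openin X U" "openin X V" "p a \<in> U" "q b \<in> V" "disjnt U V"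
    using X unfolding Hausdorff_space_def by metis
  obtain m where m: "p ` (C \<inter> cyl a m) \<subseteq> U"
    using C(2) ab(1) UV unfolding continuous_map_iff_cyl by blast
  obtain n where n: "q ` (D \<inter> cyl b n) \<subseteq> V"
    using D(2) ab(2) UV unfolding continuous_map_iff_cyl by blast
  have "p ` (C \<inter> cyl a (max m n)) \<subseteq> U" "q ` (D \<inter> cyl b (max m n)) \<subseteq> V"
    using m n cyl_antimono[of m "max m n" a] cyl_antimono[of n "max m n" b] by (auto, blast+)
  then have "sep (p ` (C \<inter> cyl a (max m n))) (q ` (D \<inter> cyl b (max m n)))"
    unfolding sep_def using UV openin_borel_sets_of[of X U]
    by (intro bexI[of _ U]) (auto simp: disjnt_def)
  then show False
    using nsep by blast
qed

text \<open>The balls of radius \<open>inverse (Suc n)\<close> about the points of a countable dense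
  set form a base.\<close>

lemma separable_metrizable_imp_second_countable:
  assumes "metrizable_space X" "separable_space X"
  shows "second_countable X"
proof -
  obtain M d where Md: "Metric_space M d" and X: "X = Metric_space.mtopology M d"
    using assms(1) unfolding metrizable_space_def by blast
  interpret Metric_space M d by (rule Md)
  obtain C where C: "countable C" "C \<subseteq> M" "X closure_of C = M"
    using assms(2) unfolding separable_space_def by (auto simp: X)
  define \<B> where "\<B> = (\<lambda>(c, n). mball c (inverse (Suc n))) ` (C \<times> (UNIV :: nat set))"
  show ?thesis
    unfolding second_countable_def
  proof (intro exI[of _ \<B>] conjI ballI allI impI)
    show "countable \<B>"
      unfolding \<B>_def using C(1) by simp
    show "openin X V" if "V \<in> \<B>" for V
      using that by (auto simp: \<B>_def X)
    fix U x assume "openin X U \<and> x \<in> U"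
    then obtain r where r: "r > 0" "mball x r \<subseteq> U" and x: "x \<in> M"
      unfolding X openin_mtopology by blast
    obtain n where n: "inverse (Suc n) < r / 2"
      using r(1) reals_Archimedean[of "r / 2"] by auto
    have "x \<in> mtopology closure_of C"
      using C(3) x by (simp add: X)
    then obtain c where c: "c \<in> C" "c \<in> mball x (inverse (Suc n))"
      unfolding metric_closure_of using n by (auto simp del: mball_def in_mball) (metis inverse_positive_iff_positive of_nat_0_less_iff zero_less_Suc of_nat_Suc)
    have "y \<in> mball x r" if "y \<in> mball c (inverse (Suc n))" for y
    proof -
      have "d x y \<le> d x c + d c y"
        using that c x by (intro triangle) auto
      then show ?thesis
        using that c n by auto
    qed
    moreover have "x \<in> mball c (inverse (Suc n))"
      using c by (auto simp: commute)
    ultimately show "\<exists>V\<in>\<B>. x \<in> V \<and> V \<subseteq> U"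
      using c(1) r(2) by (intro bexI[of _ "mball c (inverse (Suc n))"]) (auto simp: \<B>_def)
  qed
qed

section \<open>Category and the Vitali graph\<close>

section \<open>The Baire property in the Cantor space\<close>

definition comeager :: "'a::topological_space set \<Rightarrow> bool" where
  "comeager S \<longleftrightarrow>
     (\<exists>D. (\<forall>n :: nat. open (D n) \<and> (\<forall>V. open V \<longrightarrow> V \<noteq> {} \<longrightarrow> V \<inter> D n \<noteq> {})) \<and> (\<Inter>n. D n) \<subseteq> S)"

lemma comeagerE:
  assumes "comeager S"
  obtains D where "\<And>n :: nat. open (D n)" "\<And>n V. open V \<Longrightarrow> V \<noteq> {} \<Longrightarrow> V \<inter> D n \<noteq> {}"
    "(\<Inter>n. D n) \<subseteq> S"
  using assms unfolding comeager_def by (elim exE conjE) (rule that, simp_all)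

lemma comeager_mono: "comeager S \<Longrightarrow> S \<subseteq> T \<Longrightarrow> comeager T"
  unfolding comeager_def by (meson subset_trans)

lemma comeager_open_dense:
  assumes "open D" "\<And>V. open V \<Longrightarrow> V \<noteq> {} \<Longrightarrow> V \<inter> D \<noteq> {}"
  shows "comeager D"
  unfolding comeager_def using assms by (intro exI[of _ "\<lambda>_. D"]) auto

lemma comeager_INT:
  assumes "\<And>n :: nat. comeager (S n)"
  shows "comeager (\<Inter>n. S n)"
proof -
  have "\<forall>n. \<exists>D. (\<forall>k :: nat. open (D k) \<and> (\<forall>V. open V \<longrightarrow> V \<noteq> {} \<longrightarrow> V \<inter> D k \<noteq> {})) \<and> (\<Inter>k. D k) \<subseteq> S n"
    using assms unfolding comeager_def by blast
  then obtain D where D: "\<And>n k. open (D n k)" "\<And>n k V. open V \<Longrightarrow> V \<noteq> {} \<Longrightarrow> V \<inter> D n k \<noteq> {}"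
      "\<And>n. (\<Inter>k :: nat. D n k) \<subseteq> S n"
    by metis
  let ?D = "\<lambda>m. D (fst (prod_decode m)) (snd (prod_decode m))"
  have "x \<in> S n" if "x \<in> (\<Inter>m. ?D m)" for x n
  proof -
    have "x \<in> D n k" for k
      using that[THEN INT_D, of "prod_encode (n, k)"] by simp
    then show ?thesis
      using D(3) by blast
  qed
  then have "(\<Inter>m. ?D m) \<subseteq> (\<Inter>n. S n)"
    by blast
  then show ?thesis
    unfolding comeager_def using D(1,2) by (intro exI[of _ ?D]) auto
qed

lemma comeager_Int:
  assumes "comeager S" "comeager T"
  shows "comeager (S \<inter> T)"
proof -
  have "comeager (\<Inter>n::nat. if n = 0 then S else T)"
    by (rule comeager_INT) (use assms in auto)
  then show ?thesis
    by (rule comeager_mono) (auto split: if_splits)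
qed

text \<open>The formula says that the symmetric difference of \<open>B\<close> and an open set is
  meager.\<close>

definition baire_property :: "'a::topological_space set \<Rightarrow> bool" where
  "baire_property B \<longleftrightarrow> (\<exists>U. open U \<and> comeager {x. x \<in> B \<longleftrightarrow> x \<in> U})"

lemma baire_property_open: "open U \<Longrightarrow> baire_property U"
  unfolding baire_property_def by (intro exI[of _ U]) (auto intro: comeager_open_dense)

text \<open>If \<open>B\<close> agrees with \<open>U\<close> up to a meager set, then its complement
  agrees with the exterior of \<open>U\<close>, because the boundary of an open set is nowhere
  dense.\<close>

lemma baire_property_Compl:
  assumes "baire_property B"
  shows "baire_property (- B)"
proof -
  obtain U where U: "open U" "comeager {x. x \<in> B \<longleftrightarrow> x \<in> U}"
    using assms unfolding baire_property_def by blast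
  have "comeager (U \<union> - closure U)"
  proof (rule comeager_open_dense)
    show "open (U \<union> - closure U)"
      using U(1) by auto
    show "V \<inter> (U \<union> - closure U) \<noteq> {}" if "open V" "V \<noteq> {}" for V
    proof (cases "V \<inter> U = {}")
      case True
      then have "V \<inter> closure U = {}"
        using that(1) by (simp add: open_Int_closure_eq_empty)
      then show ?thesis
        using that(2) by blast
    qed auto
  qed
  from comeager_Int[OF U(2) this] have "comeager {x. x \<in> - B \<longleftrightarrow> x \<in> - closure U}"
    by (rule comeager_mono) (use closure_subset in auto)
  then show ?thesis
    unfolding baire_property_def by (intro exI[of _ "- closure U"]) auto
qed

lemma baire_property_UN:
  assumes "\<And>n :: nat. baire_property (B n)"
  shows "baire_property (\<Union>n. B n)"
proof -
  obtain U where U: "\<And>n. open (U n)" "\<And>n. comeager {x. x \<in> B n \<longleftrightarrow> x \<in> U n}"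
    using assms unfolding baire_property_def by metis
  from comeager_INT[of "\<lambda>n. {x. x \<in> B n \<longleftrightarrow> x \<in> U n}", OF U(2)]
  have "comeager {x. x \<in> (\<Union>n. B n) \<longleftrightarrow> x \<in> (\<Union>n. U n)}"
    by (rule comeager_mono) auto
  then show ?thesis
    unfolding baire_property_def using U(1) by (intro exI[of _ "\<Union>n. U n"]) auto
qed

lemma baire_property_vimage:
  assumes f: "continuous_map euclidean X f" and B: "B \<in> borel_sets_of X"
  shows "baire_property (f -` B)"
  using B unfolding borel_sets_of_def
proof (induction rule: sigma_sets.induct)
  case (Basic U)
  then have "openin euclidean {x \<in> topspace euclidean. f x \<in> U}"
    using openin_continuous_map_preimage[OF f] by simp
  then show ?case
    by (intro baire_property_open) (simp add: vimage_def)
next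
  case (Compl E)
  have "f -` (topspace X - E) = - (f -` E)"
    using continuous_map_image_subset_topspace[OF f] by auto
  then show ?case
    using Compl baire_property_Compl by simp
next
  case (Union E)
  then show ?case
    using baire_property_UN[of "\<lambda>n. f -` E n"] by (simp add: vimage_UN)
qed (auto intro: baire_property_open)

text \<open>This is the Baire category theorem; complete metrizability comes from viewing the space
  as a countable product of discrete spaces.\<close>

lemma cantor_comeager_meets_open:
  fixes S :: "(nat \<Rightarrow> bool) set"
  assumes "comeager S" "open U" "U \<noteq> {}"
  shows "U \<inter> S \<noteq> {}"
proof -
  have bool: "euclidean = discrete_topology (UNIV :: bool set)"
    by (simp add: topology_eq open_discrete)
  have "completely_metrizable_space (product_topology (\<lambda>i::nat. discrete_topology (UNIV :: bool set)) UNIV)"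
    unfolding completely_metrizable_space_product_topology
    by (intro disjI2 conjI ballI completely_metrizable_space_discrete_topology) simp
  then have *: "completely_metrizable_space (euclidean :: (nat \<Rightarrow> bool) topology)"
    by (simp only: bool[symmetric] euclidean_product_topology)
  obtain D where D: "\<And>n :: nat. open (D n)" "\<And>n V. open V \<Longrightarrow> V \<noteq> {} \<Longrightarrow> V \<inter> D n \<noteq> {}" "(\<Inter>n. D n) \<subseteq> S"
    using assms(1) by (rule comeagerE) (rule that)
  have "euclidean closure_of (\<Inter>(range D)) = topspace euclidean"
  proof (rule Baire_category)
    fix T assume "T \<in> range D"
    then show "openin euclidean T \<and> euclidean closure_of T = topspace euclidean"
      unfolding dense_intersects_open using D(1,2) by (auto simp: Int_commute)
  qed (use * in auto)
  then have "\<Inter>(range D) \<inter> U \<noteq> {}"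
    unfolding dense_intersects_open using assms by auto
  then show ?thesis
    using D(3) by blast
qed

text \<open>A nonmeager set with the Baire property is comeager in some cylinder, and flipping a single
  coordinate not fixed by that cylinder yields a pair of adjacent points of the set.\<close>

lemma vitali_graph_no_countable_cover:
  fixes B :: "nat \<Rightarrow> (nat \<Rightarrow> bool) set"
  assumes "(\<Union>n. B n) = UNIV" "\<And>n. baire_property (B n)"
  shows "\<exists>n. \<exists>x\<in>B n. \<exists>y\<in>B n. (x, y) \<in> vitali_graph"
proof -
  obtain U where U: "\<And>n. open (U n)" "\<And>n. comeager {x. x \<in> B n \<longleftrightarrow> x \<in> U n}"
    using assms(2) unfolding baire_property_def by metis
  have "comeager (\<Inter>n. {x. x \<in> B n \<longleftrightarrow> x \<in> U n})"
    using U(2) by (rule comeager_INT)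
  \<comment> \<open>At this point every \<open>B n\<close> agrees with its \<open>U n\<close>; as
    some \<open>B n\<close> contains it, some \<open>U n\<close> is nonempty.\<close>
  then obtain x where "x \<in> (\<Inter>n. {x. x \<in> B n \<longleftrightarrow> x \<in> U n})"
    using cantor_comeager_meets_open[of _ UNIV] by blast
  then obtain n a where "a \<in> U n"
    using assms(1) by blast
  then obtain m where m: "cyl a m \<subseteq> U n"
    using U(1) open_iff_cyl by blast
  \<comment> \<open>Coordinate \<open>m\<close> is the first one not fixed by
    \<open>cyl a m\<close>, so this involution preserves the cylinder.\<close>
  define flip where "flip b = b(m := \<not> b m)" for b :: "nat \<Rightarrow> bool"
  have flip_flip: "flip (flip b) = b" for b
    by (simp add: flip_def)
  have flip_open: "open (flip -` V)" if "open V" for V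
    unfolding open_iff_cyl
  proof
    fix b assume "b \<in> flip -` V"
    then obtain k where k: "cyl (flip b) k \<subseteq> V"
      using \<open>open V\<close>[unfolded open_iff_cyl] by auto
    have "flip c \<in> cyl (flip b) k" if "c \<in> cyl b k" for c
      using that by (auto simp: flip_def cyl_def)
    then show "\<exists>k. cyl b k \<subseteq> flip -` V"
      using k by blast
  qed
  obtain D where D: "\<And>k :: nat. open (D k)" "\<And>k V. open V \<Longrightarrow> V \<noteq> {} \<Longrightarrow> V \<inter> D k \<noteq> {}"
      "(\<Inter>k. D k) \<subseteq> {x. x \<in> B n \<longleftrightarrow> x \<in> U n}"
    using U(2)[of n] by (rule comeagerE) (rule that)
  \<comment> \<open>Being a homeomorphism, \<open>flip\<close> pulls dense open sets back to dense
    open sets. Hence some \<open>z\<close> in the cylinder lies in the agreement set together with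
    \<open>flip z\<close>.\<close>
  have "V \<inter> flip -` D k \<noteq> {}" if "open V" "V \<noteq> {}" for V k
  proof -
    obtain v where "v \<in> V"
      using \<open>V \<noteq> {}\<close> by blast
    then have "flip v \<in> flip -` V"
      by (simp add: flip_flip)
    then obtain z where "z \<in> flip -` V" "z \<in> D k"
      using D(2)[OF flip_open[OF \<open>open V\<close>]] by auto
    then have "flip z \<in> V \<inter> flip -` D k"
      using flip_flip by simp
    then show ?thesis
      by blast
  qed
  then have "comeager (\<Inter>k. flip -` D k)"
    unfolding comeager_def using flip_open D(1) by (intro exI[of _ "\<lambda>k. flip -` D k"]) auto
  from cantor_comeager_meets_open[OF comeager_Int[OF this U(2)[of n]] open_cyl[of a m]]
  obtain z where z: "z \<in> cyl a m" "z \<in> (\<Inter>k. flip -` D k)" "z \<in> B n \<longleftrightarrow> z \<in> U n"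
    using self_in_cyl by blast
  have "flip z \<in> (\<Inter>k. D k)"
    using z(2) by auto
  moreover have "flip z \<in> cyl a m"
    using z(1) by (simp add: cyl_def flip_def)
  ultimately have "flip z \<in> B n" "z \<in> B n"
    using D(3) m z by blast+
  moreover have "(z, flip z) \<in> vitali_graph"
  proof -
    have "{i. z i \<noteq> flip z i} = {m}"
      by (auto simp: flip_def)
    then show ?thesis
      by (force simp: vitali_graph_def)
  qed
  ultimately show ?thesis
    by blast
qed

section \<open>The action, the graphs and translates of sets\<close>

section \<open>Sets covered by countably many Borel anticliques\<close>

locale open_graph_action =
  fixes \<Gamma> :: "('g, 'm) monoid_scheme" (structure)
    and X :: "'a topology"
    and \<phi> :: "'g \<Rightarrow> 'a \<Rightarrow> 'a"
    and H :: "('a \<times> 'a) set"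
  assumes group_\<Gamma>: "group \<Gamma>" and countable_\<Gamma>: "countable (carrier \<Gamma>)"
    and polish_X: "polish_space_top X"
    and continuous_\<phi>: "continuous_action \<Gamma> X \<phi>"
    and free_\<phi>: "free_action \<Gamma> (topspace X) \<phi>"
    and graph_H: "graph_on (topspace X) H"
    and open_H: "openin (prod_topology X X) H"
    and invariant_H: "invariant_rel \<Gamma> \<phi> H"
begin

sublocale group \<Gamma>
  by (rule group_\<Gamma>)

sublocale group_action \<Gamma> "topspace X" \<phi>
  using continuous_\<phi> unfolding continuous_action_def by blast

lemma metrizable_X: "metrizable_space X"
  using polish_X unfolding polish_space_top_def
  by (blast intro: completely_metrizable_imp_metrizable_space)

lemma Hausdorff_X: "Hausdorff_space X"
  using metrizable_X by (rule metrizable_imp_Hausdorff_space)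

lemma second_countable_X: "second_countable X"
  using polish_X metrizable_X unfolding polish_space_top_def
  by (blast intro: separable_metrizable_imp_second_countable)

lemma act_in [simp]: "g \<in> carrier \<Gamma> \<Longrightarrow> x \<in> topspace X \<Longrightarrow> \<phi> g x \<in> topspace X"
  using element_image by blast

lemma act_one [simp]: "x \<in> topspace X \<Longrightarrow> \<phi> \<one> x = x"
  using id_eq_one by (metis restrict_apply')

lemma act_inv [simp]:
  "g \<in> carrier \<Gamma> \<Longrightarrow> x \<in> topspace X \<Longrightarrow> \<phi> (inv g) (\<phi> g x) = x"
  "g \<in> carrier \<Gamma> \<Longrightarrow> x \<in> topspace X \<Longrightarrow> \<phi> g (\<phi> (inv g) x) = x"
  using composition_rule[of x "inv g" g] composition_rule[of x g "inv g"] by auto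

text \<open>Freeness enters the argument through this cancellation.\<close>

lemma act_eqD:
  assumes "g \<in> carrier \<Gamma>" "h \<in> carrier \<Gamma>" "x \<in> topspace X" "\<phi> g x = \<phi> h x"
  shows "g = h"
proof -
  have "\<phi> (inv h \<otimes> g) x = x"
    using assms by (simp add: composition_rule)
  then have "inv h \<otimes> g = \<one>"
    using assms free_\<phi> unfolding free_action_def by (meson inv_closed m_closed)
  then show ?thesis
    using assms by (metis inv_closed inv_equality inv_inv)
qed

lemma continuous_act [simp]:
  assumes "g \<in> carrier \<Gamma>"
  shows "continuous_map X X (\<phi> g)"
proof -
  have "continuous_map X (prod_topology (discrete_topology (carrier \<Gamma>)) X) (\<lambda>x. (g, x))"
    using assms by (simp add: continuous_map_pairedI)
  then have "continuous_map X X ((\<lambda>(g, x). \<phi> g x) \<circ> (\<lambda>x. (g, x)))"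
    using continuous_\<phi> unfolding continuous_action_def by (blast intro: continuous_map_compose)
  then show ?thesis
    by (simp add: o_def)
qed

text \<open>Rewriting a preimage as an image makes \<open>souslin_in_image\<close> applicable to
  it.\<close>

lemma act_image_inv:
  assumes "g \<in> carrier \<Gamma>" "W \<subseteq> topspace X"
  shows "\<phi> (inv g) ` W = {x \<in> topspace X. \<phi> g x \<in> W}"
proof safe
  fix x assume "x \<in> topspace X" "\<phi> g x \<in> W"
  then show "x \<in> \<phi> (inv g) ` W"
    using assms by (intro image_eqI[of _ _ "\<phi> g x"]) auto
qed (use assms in \<open>auto simp: subset_iff\<close>)

lemma H_act: "(x, y) \<in> H \<Longrightarrow> g \<in> carrier \<Gamma> \<Longrightarrow> (\<phi> g x, \<phi> g y) \<in> H"
  using invariant_H unfolding invariant_rel_def by blast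

lemma H_sym: "(x, y) \<in> H \<Longrightarrow> (y, x) \<in> H"
  using graph_H unfolding graph_on_def sym_def by blast

lemma H_irrefl: "(x, x) \<notin> H"
  using graph_H unfolding graph_on_def irrefl_def by blast

lemma openin_edges:
  assumes "g \<in> carrier \<Gamma>"
  shows "openin X {x \<in> topspace X. (x, \<phi> g x) \<in> H}"
  using openin_continuous_map_preimage[OF _ open_H, of X "\<lambda>x. (x, \<phi> g x)"] assms
  by (simp add: continuous_map_pairedI)

section \<open>The ideal and its non-null analytic sets\<close>

abbreviation G :: "('a \<times> 'a) set" where
  "G \<equiv> H \<inter> orbit_equivalence \<Gamma> (topspace X) \<phi>"

lemma G_iff: "(x, y) \<in> G \<longleftrightarrow> (x, y) \<in> H \<and> x \<in> topspace X \<and> (\<exists>g\<in>carrier \<Gamma>. y = \<phi> g x)"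
  by (auto simp: orbit_equivalence_def orbit_def)

abbreviation null :: "'a set \<Rightarrow> bool" where
  "null W \<equiv> W \<in> sigma_ideal_generated (topspace X) {B \<in> borel_sets_of X. anticlique (topspace X) G B}"

lemma null_iff:
  "null W \<longleftrightarrow> (\<exists>\<C>. countable \<C> \<and> \<C> \<subseteq> {B \<in> borel_sets_of X. anticlique (topspace X) G B} \<and> W \<subseteq> \<Union>\<C>)"
  by (rule sigma_ideal_generated_iff) (auto simp: anticlique_def)

lemma null_subset: "null W \<Longrightarrow> V \<subseteq> W \<Longrightarrow> null V"
  unfolding null_iff by (meson subset_trans)

lemma null_UN:
  assumes "countable J" "\<And>j. j \<in> J \<Longrightarrow> null (W j)"
  shows "null (\<Union>j\<in>J. W j)"
proof -
  have "\<forall>j\<in>J. \<exists>\<C>. countable \<C> \<and> \<C> \<subseteq> {B \<in> borel_sets_of X. anticlique (topspace X) G B} \<and> W j \<subseteq> \<Union>\<C>"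
    using assms(2) unfolding null_iff by blast
  then obtain \<C> where "\<And>j. j \<in> J \<Longrightarrow> countable (\<C> j) \<and>
      \<C> j \<subseteq> {B \<in> borel_sets_of X. anticlique (topspace X) G B} \<and> W j \<subseteq> \<Union>(\<C> j)"
    by metis
  note \<C> = this
  have "countable (\<Union>j\<in>J. \<C> j)"
    using assms(1) \<C> by blast
  moreover have "(\<Union>j\<in>J. \<C> j) \<subseteq> {B \<in> borel_sets_of X. anticlique (topspace X) G B}"
    using \<C> by (intro UN_least) blast
  moreover have "(\<Union>j\<in>J. W j) \<subseteq> \<Union>(\<Union>j\<in>J. \<C> j)"
  proof (rule UN_least)
    fix j assume j: "j \<in> J"
    then have "W j \<subseteq> \<Union>(\<C> j)"
      using \<C> by blast
    also have "\<dots> \<subseteq> \<Union>(\<Union>j\<in>J. \<C> j)"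
      using j by (intro Union_mono) auto
    finally show "W j \<subseteq> \<Union>(\<Union>j\<in>J. \<C> j)" .
  qed
  ultimately show ?thesis
    unfolding null_iff by blast
qed

lemma null_Un: "null V \<Longrightarrow> null W \<Longrightarrow> null (V \<union> W)"
  using null_UN[of "{True, False}" "\<lambda>b. if b then V else W"] by (simp add: Un_commute)

text \<open>Removing a Borel set, unlike removing an arbitrary null set, keeps an analytic set
  analytic.\<close>

lemma null_Borel_cover: "null W \<Longrightarrow> \<exists>D\<in>borel_sets_of X. null D \<and> W \<subseteq> D"
proof -
  assume "null W"
  then obtain \<C> where \<C>: "countable \<C>" "\<C> \<subseteq> {B \<in> borel_sets_of X. anticlique (topspace X) G B}" "W \<subseteq> \<Union>\<C>"
    unfolding null_iff by blast
  interpret sigma_algebra "topspace X" "borel_sets_of X"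
    by (rule sigma_algebra_borel_sets_of)
  have "\<Union>\<C> \<in> borel_sets_of X"
    using \<C> by (intro countable_Union) auto
  moreover have "null (\<Union>\<C>)"
    unfolding null_iff using \<C> by blast
  ultimately show ?thesis
    using \<C>(3) by blast
qed

text \<open>For each \<open>g\<close>, the points of \<open>W\<close> adjacent to their \<open>g\<close>-translate are separated from those
  whose \<open>g\<close>-translate lies in \<open>W\<close>; together, the separating sets carve out a Borel anticlique.\<close>

lemma null_if_souslin_anticlique:
  assumes W: "souslin_in X W" and anti: "anticlique (topspace X) G W"
  shows "null W"
proof -
  interpret sigma_algebra "topspace X" "borel_sets_of X"
    by (rule sigma_algebra_borel_sets_of)
  have WX: "W \<subseteq> topspace X"
    using W by (rule souslin_in_subset)
  define N where "N g = {x \<in> topspace X. (x, \<phi> g x) \<in> H}" for g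
  have N: "N g \<in> borel_sets_of X" if "g \<in> carrier \<Gamma>" for g
    unfolding N_def using that by (intro openin_borel_sets_of openin_edges)
  have "\<exists>C\<in>borel_sets_of X. W \<inter> N g \<subseteq> C \<and> C \<inter> \<phi> (inv g) ` W = {}" if g: "g \<in> carrier \<Gamma>" for g
  proof (rule souslin_separation[OF Hausdorff_X])
    show "souslin_in X (W \<inter> N g)"
      using souslin_in_Borel(1)[OF metrizable_X N[OF g] W] .
    show "souslin_in X (\<phi> (inv g) ` W)"
      using W g by (simp add: souslin_in_image)
    show "W \<inter> N g \<inter> \<phi> (inv g) ` W = {}"
      using anti g unfolding act_image_inv[OF g WX] anticlique_def N_def G_iff by blast
  qed
  then obtain C where C: "\<And>g. g \<in> carrier \<Gamma> \<Longrightarrow> C g \<in> borel_sets_of X"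
      "\<And>g. g \<in> carrier \<Gamma> \<Longrightarrow> W \<inter> N g \<subseteq> C g" "\<And>g. g \<in> carrier \<Gamma> \<Longrightarrow> C g \<inter> \<phi> (inv g) ` W = {}"
    by metis
  \<comment> \<open>A point of \<open>E g\<close> adjacent to its \<open>g\<close>-translate lies in
    \<open>C g\<close>, while no point of \<open>E g\<close> is the \<open>g\<close>-translate of a
    point of \<open>C g\<close>. So \<open>E g\<close> contains no edge of the form
    \<open>(x, \<phi> g x)\<close>.\<close>
  define E where "E g = (C g \<union> (topspace X - N g)) \<inter> (\<phi> (inv g) -` (topspace X - C g) \<inter> topspace X)" for g
  have "E g \<in> borel_sets_of X" if g: "g \<in> carrier \<Gamma>" for g
  proof -
    have "\<phi> (inv g) -` (topspace X - C g) \<inter> topspace X \<in> borel_sets_of X"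
      using C(1) g by (intro vimage_borel_sets_of) auto
    then show ?thesis
      unfolding E_def using C(1)[OF g] N[OF g] by blast
  qed
  then have Bor: "(\<Inter>g\<in>carrier \<Gamma>. E g) \<in> borel_sets_of X"
    using countable_\<Gamma> by (intro countable_INT') auto
  have "W \<subseteq> E g" if g: "g \<in> carrier \<Gamma>" for g
  proof
    fix x assume x: "x \<in> W"
    then have "\<phi> (inv g) x \<notin> C g" "x \<in> topspace X"
      using C(3)[OF g] WX by blast+
    then show "x \<in> E g"
      unfolding E_def using C(2)[OF g] x g by auto
  qed
  moreover have "anticlique (topspace X) G (\<Inter>g\<in>carrier \<Gamma>. E g)"
    unfolding anticlique_def
  proof (intro conjI ballI)
    show "(\<Inter>g\<in>carrier \<Gamma>. E g) \<subseteq> topspace X"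
      unfolding E_def using one_closed by blast
    fix x y assume x: "x \<in> (\<Inter>g\<in>carrier \<Gamma>. E g)" and y: "y \<in> (\<Inter>g\<in>carrier \<Gamma>. E g)"
    show "(x, y) \<notin> G"
    proof
      assume "(x, y) \<in> G"
      then obtain g where g: "g \<in> carrier \<Gamma>" "y = \<phi> g x" "(x, y) \<in> H" "x \<in> topspace X"
        unfolding G_iff by blast
      then have "x \<in> C g"
        using x unfolding E_def N_def by auto
      moreover have "\<phi> (inv g) y \<notin> C g"
        using y g(1) unfolding E_def by auto
      ultimately show False
        using g by simp
    qed
  qed
  ultimately show ?thesis
    unfolding null_iff using Bor by (intro exI[of _ "{\<Inter>g\<in>carrier \<Gamma>. E g}"]) auto
qed

definition shift_edges :: "'g \<Rightarrow> 'a set \<Rightarrow> 'a set" where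
  "shift_edges g W = {x \<in> W. \<phi> g x \<in> W \<and> (x, \<phi> g x) \<in> H}"

lemma souslin_in_shift_edges:
  assumes "souslin_in X W" "g \<in> carrier \<Gamma>"
  shows "souslin_in X (shift_edges g W)"
proof -
  have "souslin_in X ((W \<inter> \<phi> (inv g) ` W) \<inter> {x \<in> topspace X. (x, \<phi> g x) \<in> H})"
    using assms metrizable_X
    by (intro souslin_in_Borel(1) openin_borel_sets_of openin_edges souslin_in_Int[OF Hausdorff_X] souslin_in_image)
       auto
  moreover have "(W \<inter> \<phi> (inv g) ` W) \<inter> {x \<in> topspace X. (x, \<phi> g x) \<in> H} = shift_edges g W"
    using souslin_in_subset[OF assms(1)] assms(2) by (auto simp: act_image_inv shift_edges_def)
  ultimately show ?thesis
    by simp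
qed

text \<open>Otherwise a null Borel set \<open>D\<close> contains the left endpoints of all
  \<open>G\<close>-edges within \<open>W\<close>. Then \<open>W - D\<close> is an analytic
  anticlique, hence null, and so is \<open>W\<close>.\<close>

lemma not_null_shift_edges:
  assumes W: "souslin_in X W" "\<not> null W"
  shows "\<exists>g\<in>carrier \<Gamma>. \<not> null (shift_edges g W)"
proof (rule ccontr)
  assume "\<not> ?thesis"
  then have "null (\<Union>g\<in>carrier \<Gamma>. shift_edges g W)"
    using countable_\<Gamma> by (intro null_UN) auto
  then obtain D where D: "D \<in> borel_sets_of X" "null D" "(\<Union>g\<in>carrier \<Gamma>. shift_edges g W) \<subseteq> D"
    using null_Borel_cover by blast
  have "souslin_in X (W - D)"
    using souslin_in_Borel(2)[OF metrizable_X D(1) W(1)] .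
  moreover have "anticlique (topspace X) G (W - D)"
    unfolding anticlique_def G_iff
    using D(3) souslin_in_subset[OF W(1)] by (auto simp: shift_edges_def)
  ultimately have "null (W - D)"
    by (rule null_if_souslin_anticlique)
  then have "null ((W - D) \<union> D)"
    using D(2) by (rule null_Un)
  then show False
    using W(2) null_subset by blast
qed

text \<open>By regularity and second countability, countably many closures of basic open sets with
  square inside \<open>R\<close> cover \<open>W\<close>, so one of them meets \<open>W\<close> in a
  non-null set. An open condition on the diagonal thus becomes one on a closed square, where it
  survives limits.\<close>

lemma not_null_localize:
  assumes W: "souslin_in X W" "\<not> null W"
    and R: "openin (prod_topology X X) R" "\<And>w. w \<in> W \<Longrightarrow> (w, w) \<in> R"
  shows "\<exists>K. closedin X K \<and> K \<times> K \<subseteq> R \<and> \<not> null (W \<inter> K)"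
proof (rule ccontr)
  assume *: "\<not> ?thesis"
  obtain \<B> where "countable \<B> \<and> (\<forall>V\<in>\<B>. openin X V) \<and>
      (\<forall>U x. openin X U \<and> x \<in> U \<longrightarrow> (\<exists>V\<in>\<B>. x \<in> V \<and> V \<subseteq> U))"
    using second_countable_X unfolding second_countable_def by (rule exE)
  then have \<B>: "countable \<B>" "\<And>V. V \<in> \<B> \<Longrightarrow> openin X V"
      "\<And>U x. openin X U \<Longrightarrow> x \<in> U \<Longrightarrow> \<exists>V\<in>\<B>. x \<in> V \<and> V \<subseteq> U"
    by simp_all
  define J where "J = {V \<in> \<B>. (X closure_of V) \<times> (X closure_of V) \<subseteq> R}"
  have "\<exists>V\<in>J. w \<in> X closure_of V" if w: "w \<in> W" for w
  proof -
    obtain U1 U2 where U: "openin X U1" "openin X U2" "w \<in> U1" "w \<in> U2" "U1 \<times> U2 \<subseteq> R"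
      using R(1) R(2)[OF w] unfolding openin_prod_topology_alt by meson
    have "neighbourhood_base_of (closedin X) X"
      using metrizable_imp_regular_space[OF metrizable_X] by (simp add: neighbourhood_base_of_closedin)
    moreover have "openin X (U1 \<inter> U2)" "w \<in> U1 \<inter> U2"
      using U by auto
    ultimately obtain O' C where C: "openin X O'" "closedin X C" "w \<in> O'" "O' \<subseteq> C" "C \<subseteq> U1 \<inter> U2"
      unfolding neighbourhood_base_of by meson
    then obtain V where V: "V \<in> \<B>" "w \<in> V" "V \<subseteq> O'"
      using \<B>(3)[of O' w] by auto
    then have "X closure_of V \<subseteq> C"
      using C by (meson closure_of_minimal subset_trans)
    then have "(X closure_of V) \<times> (X closure_of V) \<subseteq> R"
      using C U by blast
    moreover have "w \<in> X closure_of V"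
      using V(2) closure_of_subset[OF openin_subset[OF \<B>(2)[OF V(1)]]] by blast
    ultimately show ?thesis
      unfolding J_def using V by blast
  qed
  then have "W \<subseteq> (\<Union>V\<in>J. W \<inter> X closure_of V)"
    by blast
  moreover have "null (\<Union>V\<in>J. W \<inter> X closure_of V)"
  proof (rule null_UN)
    show "countable J"
      using \<B>(1) by (rule countable_subset[rotated]) (auto simp: J_def)
    show "null (W \<inter> X closure_of V)" if "V \<in> J" for V
      using * that closedin_closure_of[of X V] unfolding J_def by blast
  qed
  ultimately show False
    using W(2) null_subset by blast
qed

text \<open>One of countably many pieces always has a non-null trace; this is repeated for each of
  the finitely many \<open>s\<close>. The fusion uses it to fix the next code entry for all finite
  words at once.\<close>

lemma not_null_split:
  fixes P :: "'i \<Rightarrow> nat \<Rightarrow> 'a set"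
  assumes "finite S" "souslin_in X W" "\<not> null W"
    and P: "\<And>s k. s \<in> S \<Longrightarrow> souslin_in X (P s k)" "\<And>s. s \<in> S \<Longrightarrow> W \<subseteq> (\<Union>k. P s k)"
  shows "\<exists>\<kappa> V. V \<subseteq> W \<and> souslin_in X V \<and> \<not> null V \<and> (\<forall>s\<in>S. V \<subseteq> P s (\<kappa> s))"
  using assms(1) P
proof (induction S)
  case empty
  then show ?case
    using assms by (intro exI[of _ undefined] exI[of _ W]) auto
next
  case (insert s S)
  have "\<exists>\<kappa> V. V \<subseteq> W \<and> souslin_in X V \<and> \<not> null V \<and> (\<forall>t\<in>S. V \<subseteq> P t (\<kappa> t))"
    by (rule insert.IH) (use insert.prems in auto)
  then obtain \<kappa> V where V: "V \<subseteq> W" "souslin_in X V" "\<not> null V" "\<forall>t\<in>S. V \<subseteq> P t (\<kappa> t)"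
    by blast
  have "V \<subseteq> (\<Union>k. V \<inter> P s k)"
    using V(1) insert.prems(2)[of s] by auto
  then have "\<not> null (\<Union>k. V \<inter> P s k)"
    using V(3) null_subset by blast
  then obtain k where k: "\<not> null (V \<inter> P s k)"
    using null_UN[of UNIV "\<lambda>k. V \<inter> P s k"] by auto
  have "souslin_in X (V \<inter> P s k)"
    using V(2) insert.prems(1)[of s] souslin_in_Int[OF Hausdorff_X] by simp
  moreover have "\<forall>t\<in>insert s S. V \<inter> P s k \<subseteq> P t ((\<kappa>(s := k)) t)"
    using V(4) insert.hyps(2) by auto
  ultimately show ?case
    using k V(1) by (intro exI[of _ "\<kappa>(s := k)"] exI[of _ "V \<inter> P s k"]) auto
qed

end

lemma openin_finite_Collect_ball:
  assumes "finite S" "\<And>s. s \<in> S \<Longrightarrow> openin T {z \<in> topspace T. P s z}"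
  shows "openin T {z \<in> topspace T. \<forall>s\<in>S. P s z}"
  using assms
proof (induction S)
  case (insert s S)
  have "{z \<in> topspace T. \<forall>t\<in>insert s S. P t z} =
      {z \<in> topspace T. P s z} \<inter> {z \<in> topspace T. \<forall>t\<in>S. P t z}"
    by auto
  then show ?case
    using insert by auto
qed auto

lemma finite_bool_lists: "finite {s :: bool list. length s = n}"
  using finite_lists_length_eq[of "UNIV :: bool set" n] by simp

section \<open>The fusion construction\<close>

text \<open>Most recent digit first.\<close>

primrec rev_prefix :: "(nat \<Rightarrow> bool) \<Rightarrow> nat \<Rightarrow> bool list" where
  "rev_prefix x 0 = []"
| "rev_prefix x (Suc n) = x n # rev_prefix x n"

lemma length_rev_prefix [simp]: "length (rev_prefix x n) = n"
  by (induction n) auto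

lemma rev_prefix_eq_iff: "rev_prefix x n = rev_prefix y n \<longleftrightarrow> (\<forall>i<n. x i = y i)"
  by (induction n) (auto simp: less_Suc_eq)

section \<open>Edges given by group elements outside a finite set\<close>

context open_graph_action
begin

lemma openin_act_pair_H:
  assumes "g \<in> carrier \<Gamma>" "h \<in> carrier \<Gamma>"
  shows "openin (prod_topology X X) {z \<in> topspace X \<times> topspace X. (\<phi> g (fst z), \<phi> h (snd z)) \<in> H}"
proof -
  have "continuous_map (prod_topology X X) X (\<phi> g \<circ> fst)" "continuous_map (prod_topology X X) X (\<phi> h \<circ> snd)"
    using assms by (auto intro!: continuous_map_compose[of _ X] continuous_map_fst continuous_map_snd)
  then have "continuous_map (prod_topology X X) (prod_topology X X) (\<lambda>z. (\<phi> g (fst z), \<phi> h (snd z)))"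
    by (simp add: continuous_map_pairedI o_def)
  from openin_continuous_map_preimage[OF this open_H] show ?thesis
    by simp
qed

lemma openin_act_pair_neq:
  assumes "g \<in> carrier \<Gamma>" "h \<in> carrier \<Gamma>"
  shows "openin (prod_topology X X) {z \<in> topspace X \<times> topspace X. \<phi> g (fst z) \<noteq> \<phi> h (snd z)}"
proof -
  have "continuous_map (prod_topology X X) X (\<phi> g \<circ> fst)" "continuous_map (prod_topology X X) X (\<phi> h \<circ> snd)"
    using assms by (auto intro!: continuous_map_compose[of _ X] continuous_map_fst continuous_map_snd)
  from closedin_continuous_maps_eq[OF Hausdorff_X this]
  have "openin (prod_topology X X)
      (topspace (prod_topology X X) - {z \<in> topspace (prod_topology X X). (\<phi> g \<circ> fst) z = (\<phi> h \<circ> snd) z})"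
    by blast
  moreover have "topspace (prod_topology X X) - {z \<in> topspace (prod_topology X X). (\<phi> g \<circ> fst) z = (\<phi> h \<circ> snd) z} =
      {z \<in> topspace X \<times> topspace X. \<phi> g (fst z) \<noteq> \<phi> h (snd z)}"
    by auto
  ultimately show ?thesis
    by simp
qed

text \<open>By freeness, \<open>W\<close> is covered by countably many pieces each of which is disjoint from
  its translates by the nontrivial elements of \<open>F\<close>; so a non-null piece has all its edges outside \<open>F\<close>.\<close>

lemma not_null_shift_edges_avoiding:
  assumes W: "souslin_in X W" "\<not> null W" and F: "finite F"
  shows "\<exists>g\<in>carrier \<Gamma> - F. \<exists>V\<subseteq>W. souslin_in X V \<and> \<not> null (shift_edges g V)"
proof -
  have WX: "W \<subseteq> topspace X"
    using W(1) by (rule souslin_in_subset)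
  \<comment> \<open>No pair in \<open>R\<close> has the form \<open>(x, \<phi> g x)\<close> with
    \<open>g\<close> a nontrivial element of \<open>F\<close>. Writing \<open>\<phi> \<one>\<close>
    on the right brings the condition into the form of \<open>openin_act_pair_neq\<close>.\<close>
  define R where "R = {z \<in> topspace (prod_topology X X).
      \<forall>g\<in>F \<inter> carrier \<Gamma> - {\<one>}. \<phi> g (fst z) \<noteq> \<phi> \<one> (snd z)}"
  have "openin (prod_topology X X) R"
    unfolding R_def
  proof (rule openin_finite_Collect_ball)
    show "openin (prod_topology X X) {z \<in> topspace (prod_topology X X). \<phi> g (fst z) \<noteq> \<phi> \<one> (snd z)}"
      if "g \<in> F \<inter> carrier \<Gamma> - {\<one>}" for g
      using openin_act_pair_neq[of g \<one>] that by simp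
  qed (use F in auto)
  moreover have "(w, w) \<in> R" if "w \<in> W" for w
  proof -
    have wX: "w \<in> topspace X"
      using that WX by blast
    then have "\<phi> g w \<noteq> \<phi> \<one> w" if "g \<in> F \<inter> carrier \<Gamma> - {\<one>}" for g
      using act_eqD[of g \<one> w] that by blast
    then show ?thesis
      unfolding R_def using wX by simp
  qed
  ultimately obtain K where K: "closedin X K" "K \<times> K \<subseteq> R" "\<not> null (W \<inter> K)"
    using not_null_localize[OF W] by blast
  have V: "souslin_in X (W \<inter> K)"
    using W(1) K(1) by (rule souslin_in_Int_closedin)
  then obtain g where g: "g \<in> carrier \<Gamma>" "\<not> null (shift_edges g (W \<inter> K))"
    using not_null_shift_edges K(3) by blast
  have "null {}"
    unfolding null_iff by blast
  then obtain x where x: "x \<in> shift_edges g (W \<inter> K)"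
    using g(2) by (metis all_not_in_conv)
  then have "(x, \<phi> g x) \<in> K \<times> K" and xX: "x \<in> topspace X" and e: "(x, \<phi> g x) \<in> H"
    using WX by (auto simp: shift_edges_def)
  then have "(x, \<phi> g x) \<in> R"
    using K(2) by (simp only: subsetD)
  \<comment> \<open>An edge is not a loop, so \<open>g\<close> is nontrivial, and membership of the
    edge in \<open>R\<close> then keeps \<open>g\<close> out of \<open>F\<close>.\<close>
  from e have "g \<noteq> \<one>"
    using H_irrefl[of x] xX by auto
  then have "g \<notin> F"
    using \<open>(x, \<phi> g x) \<in> R\<close> g(1) xX unfolding R_def by auto
  then show ?thesis
    using g V by blast
qed

end

text \<open>A stage of the fusion: \<open>W\<close> is the current set of candidates for the image of the zero sequence,
  \<open>K\<close> a closed set containing it, \<open>\<gamma> s\<close> moves it to the candidates for the image of sequences starting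
  with \<open>rev s\<close>, and the first \<open>n\<close> entries of \<open>a s\<close> determine the piece of the analytic set
  in which these lie.\<close>

type_synonym ('a, 'g) stage = "'a set \<times> 'a set \<times> (bool list \<Rightarrow> 'g) \<times> (bool list \<Rightarrow> nat \<Rightarrow> nat)"

section \<open>Stages of the fusion and their refinement\<close>

locale fusion = open_graph_action \<Gamma> X \<phi> H
  for \<Gamma> :: "('g, 'm) monoid_scheme" (structure)
    and X :: "'a topology" and \<phi> H +
  fixes p :: "(nat \<Rightarrow> nat) \<Rightarrow> 'a" and e :: "nat \<Rightarrow> 'g"
  assumes continuous_p: "continuous_map euclidean X p"
    and not_null_p: "\<not> null (range p)"
    and range_e: "range e = carrier \<Gamma>"
begin

text \<open>Adjacency is demanded on the closed set \<open>K\<close>, not just on \<open>W\<close>,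
  because the limit points are only known to lie in \<open>K\<close>.\<close>

definition good :: "nat \<Rightarrow> ('a, 'g) stage \<Rightarrow> bool" where
  "good n = (\<lambda>(W, K, \<gamma>, a). souslin_in X W \<and> \<not> null W \<and> W \<subseteq> K \<and> closedin X K \<and>
     (\<forall>s. length s = n \<longrightarrow> \<gamma> s \<in> carrier \<Gamma> \<and> \<phi> (\<gamma> s) ` W \<subseteq> p ` cyl (a s) n) \<and>
     (\<forall>s t. length s = n \<longrightarrow> length t = n \<longrightarrow> s \<noteq> t \<longrightarrow>
        (\<forall>w\<in>K. \<forall>w'\<in>K. (\<phi> (\<gamma> s) w, \<phi> (\<gamma> t) w') \<in> H)))"

text \<open>The head of a word of length \<open>Suc n\<close> is coordinate \<open>n\<close> of a
  sequence. The last clause diagonalizes against \<open>e 0\<close> to \<open>e n\<close>: none of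
  them carries a candidate for one sequence to a candidate for another that differs from it at
  coordinate \<open>n\<close>.\<close>

definition refines :: "nat \<Rightarrow> ('a, 'g) stage \<Rightarrow> ('a, 'g) stage \<Rightarrow> bool" where
  "refines n = (\<lambda>(W, K, \<gamma>, a) (W', K', \<gamma>', a').
     (\<exists>g\<in>carrier \<Gamma>. W' \<subseteq> W \<and> \<phi> g ` W' \<subseteq> W \<and>
        (\<forall>s. length s = n \<longrightarrow> \<gamma>' (False # s) = \<gamma> s \<and> \<gamma>' (True # s) = \<gamma> s \<otimes> g)) \<and>
     (\<forall>i s. length s = n \<longrightarrow> a' (i # s) \<in> cyl (a s) n) \<and>
     (\<forall>i s t k. length s = n \<longrightarrow> length t = n \<longrightarrow> k \<le> n \<longrightarrow>
        (\<forall>w\<in>K'. \<forall>w'\<in>K'. \<phi> (e k) (\<phi> (\<gamma>' (i # s)) w) \<noteq> \<phi> (\<gamma>' ((\<not> i) # t)) w')))"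

lemma e_in [simp]: "e k \<in> carrier \<Gamma>"
  using range_e by blast

lemma souslin_in_cyl: "souslin_in X (p ` cyl b n)"
proof -
  have "closed (cyl b n)"
  proof (rule closed_cylI)
    fix c assume "\<And>m. cyl b n \<inter> cyl c m \<noteq> {}"
    then obtain d where "d \<in> cyl b n" "d \<in> cyl c n"
      by blast
    then show "c \<in> cyl b n"
      by (simp add: cyl_def)
  qed
  moreover have "continuous_map (top_of_set (cyl b n)) X p"
    using continuous_p by (rule continuous_map_from_subtopology)
  ultimately show ?thesis
    unfolding souslin_in_def by blast
qed

lemma good_initial: "good 0 (range p, topspace X, \<lambda>_. \<one>, \<lambda>_ _. 0)"
  using souslin_in_cyl[of undefined 0] not_null_p continuous_p
  by (auto simp: good_def continuous_map_UNIV_iff_cyl subset_iff)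

text \<open>First \<open>g\<close> is chosen outside a finite set, then the candidates are thinned
  to fix one more code entry for each word. Finally the open conditions now true on the diagonal are
  spread to a closed square by \<open>not_null_localize\<close>.\<close>

lemma good_step:
  assumes good: "good n (W, K, \<gamma>, a)"
  shows "\<exists>st. good (Suc n) st \<and> refines n (W, K, \<gamma>, a) st"
proof -
  have W: "souslin_in X W" "\<not> null W" "W \<subseteq> K"
    and \<gamma>: "\<And>s. length s = n \<Longrightarrow> \<gamma> s \<in> carrier \<Gamma>"
    and code: "\<And>s. length s = n \<Longrightarrow> \<phi> (\<gamma> s) ` W \<subseteq> p ` cyl (a s) n"
    and edge: "\<And>s t w w'. length s = n \<Longrightarrow> length t = n \<Longrightarrow> s \<noteq> t \<Longrightarrow> w \<in> K \<Longrightarrow> w' \<in> K \<Longrightarrow>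
        (\<phi> (\<gamma> s) w, \<phi> (\<gamma> t) w') \<in> H"
    using good unfolding good_def prod.case by simp_all
  define L where "L = {s :: bool list. length s = n}"
  have L: "finite L"
    unfolding L_def by (rule finite_bool_lists)
  \<comment> \<open>The two parts contain the solutions \<open>g\<close> of
    \<open>e k \<otimes> \<gamma> s = \<gamma> t \<otimes> g\<close> and of
    \<open>e k \<otimes> \<gamma> s \<otimes> g = \<gamma> t\<close>. These are the coincidences
    forbidden by the last clause of \<open>refines\<close>.\<close>
  define F where "F = (\<lambda>(s, t, k). inv (\<gamma> t) \<otimes> (e k \<otimes> \<gamma> s)) ` (L \<times> L \<times> {..n}) \<union>
      (\<lambda>(s, t, k). inv (e k \<otimes> \<gamma> s) \<otimes> \<gamma> t) ` (L \<times> L \<times> {..n})"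
  have "finite F"
    unfolding F_def using L by simp
  from not_null_shift_edges_avoiding[OF W(1,2) this]
  obtain g V where g: "g \<in> carrier \<Gamma>" "g \<notin> F" and V: "V \<subseteq> W" "souslin_in X V" "\<not> null (shift_edges g V)"
    by blast
  define W1 where "W1 = shift_edges g V"
  have W1: "souslin_in X W1" "\<not> null W1"
    unfolding W1_def using V g by (auto intro: souslin_in_shift_edges)
  have W1D: "x \<in> W" "\<phi> g x \<in> W" "(x, \<phi> g x) \<in> H" "x \<in> topspace X" if "x \<in> W1" for x
    using that V(1) souslin_in_subset[OF W1(1)] unfolding W1_def shift_edges_def by auto
  define \<delta> where "\<delta> s = (case s of [] \<Rightarrow> \<one> | i # s \<Rightarrow> if i then \<gamma> s \<otimes> g else \<gamma> s)" for s
  have \<delta>_in: "\<delta> s \<in> carrier \<Gamma>" if "length s = Suc n" for s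
    using that \<gamma> g(1) by (cases s) (auto simp: \<delta>_def)
  have \<delta>_act: "\<phi> (\<delta> (i # s)) x = \<phi> (\<gamma> s) (if i then \<phi> g x else x)"
    if "length s = n" "x \<in> topspace X" for i s x
    using that \<gamma> g(1) by (auto simp: \<delta>_def composition_rule)
  define L' where "L' = {s :: bool list. length s = Suc n}"
  have L': "finite L'"
    unfolding L'_def by (rule finite_bool_lists)
  \<comment> \<open>The old code of \<open>\<phi> (\<delta> s) x\<close> is extended by the entry
    \<open>k\<close> at position \<open>n\<close>, and the resulting piece is moved back by
    \<open>\<delta> s\<close>. Over all \<open>k\<close> these pieces cover
    \<open>W1\<close>.\<close>
  define P where "P s k = \<phi> (inv (\<delta> s)) ` p ` cyl ((a (tl s))(n := k)) (Suc n)" for s k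
  have pX: "p b \<in> topspace X" for b
    using continuous_p by (auto simp: continuous_map_UNIV_iff_cyl)
  have "\<exists>\<kappa> V. V \<subseteq> W1 \<and> souslin_in X V \<and> \<not> null V \<and> (\<forall>s\<in>L'. V \<subseteq> P s (\<kappa> s))"
  proof (rule not_null_split[OF L' W1])
    fix s assume "s \<in> L'"
    then have s: "length s = Suc n"
      by (simp add: L'_def)
    then obtain i t where it: "s = i # t" "length t = n"
      by (cases s) auto
    show "souslin_in X (P s k)" for k
      unfolding P_def using \<delta>_in[OF s] souslin_in_cyl by (auto intro!: souslin_in_image[OF souslin_in_cyl])
    show "W1 \<subseteq> (\<Union>k. P s k)"
    proof
      fix x assume x: "x \<in> W1"
      have "\<phi> (\<delta> s) x \<in> \<phi> (\<gamma> t) ` W"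
        using \<delta>_act[OF it(2) W1D(4)[OF x]] W1D[OF x] unfolding it(1) by auto
      then obtain b where b: "b \<in> cyl (a t) n" "\<phi> (\<delta> s) x = p b"
        using code[OF it(2)] by blast
      have "b \<in> cyl ((a (tl s))(n := b n)) (Suc n)"
        using b(1) it by (auto simp: cyl_def less_Suc_eq)
      moreover have "x = \<phi> (inv (\<delta> s)) (p b)"
        using b(2) \<delta>_in[OF s] W1D(4)[OF x] by (metis act_inv(1))
      ultimately show "x \<in> (\<Union>k. P s k)"
        unfolding P_def by blast
    qed
  qed
  then obtain \<kappa> W2 where W2: "W2 \<subseteq> W1" "souslin_in X W2" "\<not> null W2" "\<And>s. s \<in> L' \<Longrightarrow> W2 \<subseteq> P s (\<kappa> s)"
    by blast
  define R where "R = {z \<in> topspace (prod_topology X X). \<forall>q\<in>{q \<in> L' \<times> L'. fst q \<noteq> snd q}.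
        (\<phi> (\<delta> (fst q)) (fst z), \<phi> (\<delta> (snd q)) (snd z)) \<in> H} \<inter>
      {z \<in> topspace (prod_topology X X). \<forall>q\<in>UNIV \<times> L \<times> L \<times> {..n}.
        case q of (i, s, t, k) \<Rightarrow> \<phi> (e k \<otimes> \<delta> (i # s)) (fst z) \<noteq> \<phi> (\<delta> ((\<not> i) # t)) (snd z)}"
  have "openin (prod_topology X X) R"
    unfolding R_def
  proof (intro openin_Int openin_finite_Collect_ball)
    fix q assume "q \<in> {q \<in> L' \<times> L'. fst q \<noteq> snd q}"
    then show "openin (prod_topology X X) {z \<in> topspace (prod_topology X X).
        (\<phi> (\<delta> (fst q)) (fst z), \<phi> (\<delta> (snd q)) (snd z)) \<in> H}"
      using openin_act_pair_H[of "\<delta> (fst q)" "\<delta> (snd q)"] \<delta>_in by (auto simp: L'_def)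
  next
    fix q :: "bool \<times> bool list \<times> bool list \<times> nat" assume "q \<in> UNIV \<times> L \<times> L \<times> {..n}"
    then obtain i s t k where q: "q = (i, s, t, k)" "length s = n" "length t = n"
      by (auto simp: L_def)
    then show "openin (prod_topology X X) {z \<in> topspace (prod_topology X X).
        case q of (i, s, t, k) \<Rightarrow> \<phi> (e k \<otimes> \<delta> (i # s)) (fst z) \<noteq> \<phi> (\<delta> ((\<not> i) # t)) (snd z)}"
      using openin_act_pair_neq[of "e k \<otimes> \<delta> (i # s)" "\<delta> ((\<not> i) # t)"] \<delta>_in by simp
  qed (use L L' in auto)
  moreover have "(w, w) \<in> R" if w: "w \<in> W2" for w
  proof -
    have w1: "w \<in> W1" and wX: "w \<in> topspace X"
      using w W2(1) W1D by auto
    have "(\<phi> (\<delta> s) w, \<phi> (\<delta> t) w) \<in> H" if st: "s \<in> L'" "t \<in> L'" "s \<noteq> t" for s t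
    proof -
      obtain i u where s: "s = i # u" "length u = n"
        using st(1) by (cases s) (auto simp: L'_def)
      obtain j v where t: "t = j # v" "length v = n"
        using st(2) by (cases t) (auto simp: L'_def)
      show ?thesis
      \<comment> \<open>For different tails the edge comes from the previous stage, since
        \<open>w\<close> and \<open>\<phi> g w\<close> lie in \<open>K\<close>. For equal tails the
        heads differ, and the pair is a translate of the edge between \<open>w\<close> and
        \<open>\<phi> g w\<close>, in one order or the other.\<close>
      proof (cases "u = v")
        case False
        then show ?thesis
          unfolding s(1) t(1) \<delta>_act[OF s(2) wX] \<delta>_act[OF t(2) wX]
          using W1D[OF w1] W(3) by (intro edge[OF s(2) t(2)]) auto
      next
        case True
        then have "(\<phi> (\<gamma> u) (if i then \<phi> g w else w), \<phi> (\<gamma> u) (if j then \<phi> g w else w)) \<in> H"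
          using st(3) s t W1D(3)[OF w1] H_sym \<gamma>[OF s(2)] by (auto intro!: H_act)
        then show ?thesis
          unfolding s(1) t(1) \<delta>_act[OF s(2) wX] \<delta>_act[OF t(2) wX] True by simp
      qed
    qed
    moreover have "\<phi> (e k \<otimes> \<delta> (i # s)) w \<noteq> \<phi> (\<delta> ((\<not> i) # t)) w"
      if st: "s \<in> L" "t \<in> L" "k \<le> n" for i s t k
    proof
      have s: "length s = n" "\<gamma> s \<in> carrier \<Gamma>" and t: "length t = n" "\<gamma> t \<in> carrier \<Gamma>"
        using st \<gamma> by (auto simp: L_def)
      assume "\<phi> (e k \<otimes> \<delta> (i # s)) w = \<phi> (\<delta> ((\<not> i) # t)) w"
      then have eq: "e k \<otimes> \<delta> (i # s) = \<delta> ((\<not> i) # t)"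
        using act_eqD[OF _ _ wX] \<delta>_in s t by simp
      have "g \<in> F"
      proof (cases i)
        case True
        then have "(e k \<otimes> \<gamma> s) \<otimes> g = \<gamma> t"
          using eq s t g(1) by (simp add: \<delta>_def m_assoc)
        then have "g = inv (e k \<otimes> \<gamma> s) \<otimes> \<gamma> t"
          using s t g(1) by (metis e_in inv_solve_left m_closed)
        then show ?thesis
          unfolding F_def using st by (intro UnI2 image_eqI[of _ _ "(s, t, k)"]) auto
      next
        case False
        then have "e k \<otimes> \<gamma> s = \<gamma> t \<otimes> g"
          using eq by (simp add: \<delta>_def)
        then have "g = inv (\<gamma> t) \<otimes> (e k \<otimes> \<gamma> s)"
          using s t g(1) by (metis e_in inv_solve_left m_closed)
        then show ?thesis
          unfolding F_def using st by (intro UnI1 image_eqI[of _ _ "(s, t, k)"]) auto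
      qed
      then show False
        using g(2) by blast
    qed
    ultimately show ?thesis
      unfolding R_def using wX by auto
  qed
  ultimately obtain K' where K': "closedin X K'" "K' \<times> K' \<subseteq> R" "\<not> null (W2 \<inter> K')"
    using not_null_localize[OF W2(2,3)] by blast
  define a' where "a' s = (a (tl s))(n := \<kappa> s)" for s
  define W' where "W' = W2 \<inter> K'"
  have "good (Suc n) (W', K', \<delta>, a')"
    unfolding good_def prod.case
  proof (intro conjI allI impI ballI)
    show "souslin_in X W'" "\<not> null W'" "W' \<subseteq> K'" "closedin X K'"
      unfolding W'_def using W2(2) K' by (auto intro: souslin_in_Int_closedin)
    show "\<phi> (\<delta> s) ` W' \<subseteq> p ` cyl (a' s) (Suc n)" if s: "length s = Suc n" for s
    proof clarify
      fix w assume "w \<in> W'"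
      then have "w \<in> P s (\<kappa> s)"
        using W2(4)[of s] s by (auto simp: W'_def L'_def)
      then obtain b where "b \<in> cyl (a' s) (Suc n)" "w = \<phi> (inv (\<delta> s)) (p b)"
        unfolding P_def a'_def by blast
      then show "\<phi> (\<delta> s) w \<in> p ` cyl (a' s) (Suc n)"
        using \<delta>_in[OF s] pX by simp
    qed
    show "(\<phi> (\<delta> s) w, \<phi> (\<delta> t) w') \<in> H"
      if "length s = Suc n" "length t = Suc n" "s \<noteq> t" "w \<in> K'" "w' \<in> K'" for s t w w'
    proof -
      have "(w, w') \<in> R"
        using that K'(2) by blast
      then show ?thesis
        unfolding R_def using that by (auto simp: L'_def)
    qed
  qed (use \<delta>_in in auto)
  moreover have "refines n (W, K, \<gamma>, a) (W', K', \<delta>, a')"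
    unfolding refines_def prod.case
  proof (intro conjI allI impI ballI bexI[of _ g])
    show "W' \<subseteq> W" "\<phi> g ` W' \<subseteq> W"
      using W2(1) W1D by (auto simp: W'_def)
    show "\<phi> (e k) (\<phi> (\<delta> (i # s)) w) \<noteq> \<phi> (\<delta> ((\<not> i) # t)) w'"
      if "length s = n" "length t = n" "k \<le> n" "w \<in> K'" "w' \<in> K'" for i s t k w w'
    proof -
      have "(w, w') \<in> R" "w \<in> topspace X"
        using that K'(2) closedin_subset[OF K'(1)] by auto
      then have "\<phi> (e k \<otimes> \<delta> (i # s)) w \<noteq> \<phi> (\<delta> ((\<not> i) # t)) w'"
        unfolding R_def using that by (auto simp: L_def)
      then show ?thesis
        using \<open>w \<in> topspace X\<close> \<delta>_in that by (simp add: composition_rule)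
    qed
  qed (use g in \<open>auto simp: \<delta>_def a'_def cyl_def\<close>)
  ultimately show ?thesis
    by blast
qed

end

section \<open>The limit of the fusion\<close>

context fusion
begin

lemma continuous_reduction_exists:
  "\<exists>f :: (nat \<Rightarrow> bool) \<Rightarrow> 'a. continuous_map euclidean (subtopology X (range p)) f \<and> inj f \<and>
     reduction_on UNIV vitali_graph G f"
proof -
  have "\<exists>st. \<forall>n. good n (st n) \<and> refines n (st n) (st (Suc n))"
  proof (rule dependent_nat_choice)
    show "\<exists>st. good 0 st"
      using good_initial by blast
    show "\<exists>st'. good (Suc n) st' \<and> refines n st st'" if "good n st" for st n
      using good_step that by (cases st) blast
  qed
  then obtain st where st: "\<And>n. good n (st n)" "\<And>n. refines n (st n) (st (Suc n))"
    by blast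
  define W where "W n = fst (st n)" for n
  define K where "K n = fst (snd (st n))" for n
  define \<gamma> where "\<gamma> n = fst (snd (snd (st n)))" for n
  define a where "a n = snd (snd (snd (st n)))" for n
  have st_eq: "st n = (W n, K n, \<gamma> n, a n)" for n
    by (simp add: W_def K_def \<gamma>_def a_def)
  note good = st(1)[unfolded st_eq good_def prod.case]
  note refines = st(2)[unfolded st_eq refines_def prod.case]
  have "W n \<noteq> {}" for n
  proof -
    have "null {}"
      unfolding null_iff by blast
    then show ?thesis
      using good[of n] by auto
  qed
  then have "\<forall>n. \<exists>v. v \<in> W n"
    by blast
  then obtain w where w: "\<And>n. w n \<in> W n"
    by metis
  have WK: "W n \<subseteq> K n" and K: "closedin X (K n)" for n
    using good[of n] by simp_all
  have KX: "K n \<subseteq> topspace X" for n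
    using K closedin_subset by blast
  have "\<exists>g. g \<in> carrier \<Gamma> \<and> W (Suc n) \<subseteq> W n \<and> \<phi> g ` W (Suc n) \<subseteq> W n \<and>
      (\<forall>s. length s = n \<longrightarrow> \<gamma> (Suc n) (False # s) = \<gamma> n s \<and> \<gamma> (Suc n) (True # s) = \<gamma> n s \<otimes> g)" for n
    using conjunct1[OF refines[of n]] by blast
  then obtain g where g: "\<And>n. g n \<in> carrier \<Gamma>" "\<And>n. W (Suc n) \<subseteq> W n" "\<And>n. \<phi> (g n) ` W (Suc n) \<subseteq> W n"
    "\<And>n s. length s = n \<Longrightarrow> \<gamma> (Suc n) (False # s) = \<gamma> n s"
    "\<And>n s. length s = n \<Longrightarrow> \<gamma> (Suc n) (True # s) = \<gamma> n s \<otimes> g n"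
    by metis
  \<comment> \<open>This is \<open>\<gamma> 0 []\<close> followed by the product of the
    \<open>g i\<close> with \<open>i < n\<close> and \<open>x i\<close>, in increasing order of
    \<open>i\<close>.\<close>
  define h where "h x n = \<gamma> n (rev_prefix x n)" for x n
  have h_in [simp]: "h x n \<in> carrier \<Gamma>" for x n
    using good[of n] by (simp add: h_def)
  have h_Suc: "h x (Suc n) = (if x n then h x n \<otimes> g n else h x n)" for x n
    using g(4,5)[of "rev_prefix x n" n] by (simp add: h_def)
  \<comment> \<open>The digits from \<open>n\<close> up to \<open>m\<close> carry \<open>v\<close>
    to a point of \<open>W n\<close> that depends only on those digits, so all sequences with the
    same tail share it.\<close>
  have common_origin: "\<exists>w'\<in>W n. \<forall>y. (\<forall>i\<ge>n. y i = x i) \<longrightarrow> \<phi> (h y m) v = \<phi> (h y n) w'"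
    if "n \<le> m" "v \<in> W m" for n m x v
    using that
  proof (induction arbitrary: v rule: dec_induct)
    case base
    then show ?case
      by blast
  next
    case (step m)
    have vX: "v \<in> topspace X"
      using step.prems WK KX by blast
    define u where "u = (if x m then \<phi> (g m) v else v)"
    have "u \<in> W m"
      using step.prems g(2,3)[of m] unfolding u_def by auto
    then obtain w' where w': "w' \<in> W n" "\<forall>y. (\<forall>i\<ge>n. y i = x i) \<longrightarrow> \<phi> (h y m) u = \<phi> (h y n) w'"
      using step.IH by blast
    have "\<phi> (h y (Suc m)) v = \<phi> (h y m) u" if "\<forall>i\<ge>n. y i = x i" for y
      using that step.hyps vX g(1) by (simp add: h_Suc u_def composition_rule)
    then show ?case
      using w' by (intro bexI[of _ w']) auto
  qed
  \<comment> \<open>The entry \<open>i\<close> of the code is the one fixed at stage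
    \<open>Suc i\<close>. It depends only on the first \<open>Suc i\<close> digits of
    \<open>x\<close>, whence the continuity of \<open>f\<close>.\<close>
  define \<alpha> where "\<alpha> x = (\<lambda>i. a (Suc i) (rev_prefix x (Suc i)) i)" for x
  have \<alpha>: "\<alpha> x \<in> cyl (a n (rev_prefix x n)) n" for x n
    unfolding \<alpha>_def
  proof (rule cyl_limit)
    show "a (Suc n) (rev_prefix x (Suc n)) \<in> cyl (a n (rev_prefix x n)) n" for n
      using refines[of n] by simp
  qed
  define f where "f x = p (\<alpha> x)" for x
  have fX: "f x \<in> topspace X" for x
    using continuous_p unfolding f_def continuous_map_UNIV_iff_cyl by blast
  have continuous_p': "\<exists>n. p ` cyl (\<alpha> x) n \<subseteq> U" if "openin X U" "f x \<in> U" for x U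
    using that continuous_p unfolding f_def continuous_map_UNIV_iff_cyl by blast
  have "continuous_map euclidean X f"
    unfolding continuous_map_UNIV_iff_cyl
  proof (intro conjI allI impI)
    fix x U assume "openin X U" "f x \<in> U"
    then obtain n where n: "p ` cyl (\<alpha> x) n \<subseteq> U"
      using continuous_p' by blast
    have "f y \<in> U" if y: "y \<in> cyl x n" for y
    proof -
      have "\<alpha> y i = \<alpha> x i" if "i < n" for i
      proof -
        have "rev_prefix y (Suc i) = rev_prefix x (Suc i)"
          unfolding rev_prefix_eq_iff using y that by (simp add: cyl_def)
        then show ?thesis
          by (simp only: \<alpha>_def)
      qed
      then have "\<alpha> y \<in> cyl (\<alpha> x) n"
        by (simp add: cyl_def)
      then show ?thesis
        using n unfolding f_def by blast
    qed
    then show "\<exists>n. f ` cyl x n \<subseteq> U"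
      by blast
  qed (use fX in blast)
  then have cont: "continuous_map euclidean (subtopology X (range p)) f"
    by (auto simp: continuous_map_in_subtopology f_def)
  \<comment> \<open>The code clause of \<open>good\<close> places the \<open>m\<close>-th term in
    the image of \<open>cyl (\<alpha> x) m\<close>, and continuity of \<open>p\<close> shrinks these
    images to \<open>f x\<close>.\<close>
  have lim: "limitin X (\<lambda>m. \<phi> (h x m) (w m)) (f x) sequentially" for x
    unfolding limitin_sequentially
  proof (intro conjI allI impI fX)
    fix U assume "openin X U \<and> f x \<in> U"
    then obtain n where n: "p ` cyl (\<alpha> x) n \<subseteq> U"
      using continuous_p' by blast
    have "\<phi> (h x m) (w m) \<in> U" if "m \<ge> n" for m
    proof -
      have "\<phi> (h x m) (w m) \<in> p ` cyl (a m (rev_prefix x m)) m"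
      proof -
        have "\<phi> (\<gamma> m (rev_prefix x m)) ` W m \<subseteq> p ` cyl (a m (rev_prefix x m)) m"
          using good[of m] length_rev_prefix[of x m] by blast
        then show ?thesis
          using w[of m] unfolding h_def by blast
      qed
      also have "\<dots> = p ` cyl (\<alpha> x) m"
        using cyl_eq[OF \<alpha>] by metis
      also have "\<dots> \<subseteq> U"
        using n cyl_antimono[OF that, of "\<alpha> x"] by blast
      finally show ?thesis .
    qed
    then show "\<exists>N. \<forall>m. N \<le> m \<longrightarrow> \<phi> (h x m) (w m) \<in> U"
      by blast
  qed
  \<comment> \<open>This is \<open>common_origin\<close> in the limit; the common point stays in
    \<open>K n\<close> because that set is closed.\<close>
  have origin: "\<exists>k\<in>K n. \<forall>y. (\<forall>i\<ge>n. y i = x i) \<longrightarrow> f y = \<phi> (h y n) k" for x n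
  proof -
    have "\<exists>w'. n \<le> m \<longrightarrow> w' \<in> W n \<and> (\<forall>y. (\<forall>i\<ge>n. y i = x i) \<longrightarrow> \<phi> (h y m) (w m) = \<phi> (h y n) w')" for m
      using common_origin[of n m "w m" x] w by blast
    then obtain w' where w': "\<And>m. n \<le> m \<Longrightarrow> w' m \<in> W n"
        "\<And>m y. n \<le> m \<Longrightarrow> \<forall>i\<ge>n. y i = x i \<Longrightarrow> \<phi> (h y m) (w m) = \<phi> (h y n) (w' m)"
      by metis
    \<comment> \<open>Pulling the convergence for \<open>x\<close> back by \<open>h x n\<close>
      shows that the points \<open>w' m\<close> converge to \<open>k\<close>; pushing this forward
      by \<open>h y n\<close> then computes \<open>f y\<close>.\<close>
    define k where "k = \<phi> (inv (h x n)) (f x)"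
    have "limitin X (\<lambda>m. \<phi> (inv (h x n)) (\<phi> (h x m) (w m))) k sequentially"
      using continuous_map_limit[OF continuous_act lim, of "inv (h x n)" x] by (simp add: k_def o_def)
    moreover have "\<phi> (inv (h x n)) (\<phi> (h x m) (w m)) = w' m" if "n \<le> m" for m
    proof -
      have "w' m \<in> topspace X"
        using w'(1)[OF that] WK KX by blast
      then show ?thesis
        using w'(2)[OF that, of x] by simp
    qed
    then have "\<forall>\<^sub>F m in sequentially. \<phi> (inv (h x n)) (\<phi> (h x m) (w m)) = w' m"
      unfolding eventually_sequentially by blast
    ultimately have lim_k: "limitin X w' k sequentially"
      by (rule limitin_transform_eventually[rotated])
    have "\<forall>\<^sub>F m in sequentially. w' m \<in> K n"
      unfolding eventually_sequentially using w'(1) WK by blast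
    then have "k \<in> K n"
      using limitin_closedin[OF lim_k K] by simp
    moreover have "f y = \<phi> (h y n) k" if y: "\<forall>i\<ge>n. y i = x i" for y
    proof -
      have "limitin X (\<lambda>m. \<phi> (h y n) (w' m)) (\<phi> (h y n) k) sequentially"
        using continuous_map_limit[OF continuous_act lim_k, of "h y n"] by (simp add: o_def)
      moreover have "\<forall>\<^sub>F m in sequentially. \<phi> (h y n) (w' m) = \<phi> (h y m) (w m)"
        unfolding eventually_sequentially using w'(2)[OF _ y] by metis
      ultimately have "limitin X (\<lambda>m. \<phi> (h y m) (w m)) (\<phi> (h y n) k) sequentially"
        by (rule limitin_transform_eventually[rotated])
      then show ?thesis
        using limitin_Hausdorff_unique[OF lim[of y] _ _ Hausdorff_X] by simp
    qed
    ultimately show ?thesis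
      by blast
  qed
  have adjacent: "(f x, f y) \<in> G" if "(x, y) \<in> vitali_graph" for x y
  proof -
    have "finite {i. x i \<noteq> y i}" and "x \<noteq> y"
      using that by (auto simp: vitali_graph_def)
    then obtain n where n: "\<forall>i\<ge>n. y i = x i"
      unfolding finite_nat_iff_bounded by (auto simp: subset_iff) (metis not_le)
    then obtain k where k: "k \<in> K n" "f x = \<phi> (h x n) k" "f y = \<phi> (h y n) k"
      using origin[of n x] by auto
    obtain i where i: "x i \<noteq> y i"
      using \<open>x \<noteq> y\<close> by blast
    then have "i < n"
      using n by (metis not_le)
    then have "rev_prefix x n \<noteq> rev_prefix y n"
      unfolding rev_prefix_eq_iff using i by blast
    then have "(f x, f y) \<in> H"
      using good[of n] k unfolding h_def by simp
    moreover have "f y = \<phi> (h y n \<otimes> inv (h x n)) (f x)"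
      using k KX by (auto simp: composition_rule subset_iff)
    ultimately show ?thesis
      unfolding G_iff using fX by (intro conjI bexI[of _ "h y n \<otimes> inv (h x n)"]) simp_all
  qed
  have separated: "\<phi> b (f x) \<noteq> f y" if "(x, y) \<notin> vitali_graph" "x \<noteq> y" "b \<in> carrier \<Gamma>" for x y b
  proof -
    obtain j where j: "b = e j"
      using \<open>b \<in> carrier \<Gamma>\<close> range_e by blast
    have "infinite {i. x i \<noteq> y i}"
      using that by (simp add: vitali_graph_def)
    \<comment> \<open>Since \<open>b\<close> is \<open>e j\<close> with \<open>j \<le> n\<close>,
      passing from stage \<open>n\<close> to stage \<open>Suc n\<close> rules it out at a coordinate
      where \<open>x\<close> and \<open>y\<close> differ.\<close>
    then obtain n where n: "n \<ge> j" "x n \<noteq> y n"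
      unfolding infinite_nat_iff_unbounded_le by blast
    obtain k k' where k: "k \<in> K (Suc n)" "f x = \<phi> (h x (Suc n)) k"
        and k': "k' \<in> K (Suc n)" "f y = \<phi> (h y (Suc n)) k'"
      using origin[of "Suc n" x] origin[of "Suc n" y] by blast
    have "y n = (\<not> x n)"
      using n(2) by auto
    then have "\<phi> (e j) (\<phi> (h x (Suc n)) k) \<noteq> \<phi> (h y (Suc n)) k'"
      using refines[of n] k(1) k'(1) n(1) unfolding h_def by simp
    then show ?thesis
      using k k' j by simp
  qed
  have "reduction_on UNIV vitali_graph G f"
    unfolding reduction_on_def
  proof (intro ballI iffI)
    fix x y assume "(f x, f y) \<in> G"
    then obtain b where "b \<in> carrier \<Gamma>" "f y = \<phi> b (f x)" "(f x, f y) \<in> H"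
      unfolding G_iff by blast
    then show "(x, y) \<in> vitali_graph"
      using separated H_irrefl by metis
  qed (use adjacent in blast)
  \<comment> \<open>Distinct Vitali-adjacent points have \<open>H\<close>-adjacent, hence distinct,
    images; for other distinct points \<open>separated\<close> is applied to the identity.\<close>
  moreover have "inj f"
  proof (rule injI, rule ccontr)
    fix x y assume "f x = f y" "x \<noteq> y"
    then show False
      using adjacent[of x y] separated[of x y \<one>] H_irrefl[of "f x"] fX[of x] by auto
  qed
  ultimately show ?thesis
    using cont by blast
qed

end

section \<open>The dichotomy\<close>

theorem theorem4p6:
  fixes \<Gamma> :: "('g, 'm) monoid_scheme"
    and X :: "'a topology"
    and \<phi> :: "'g \<Rightarrow> 'a \<Rightarrow> 'a"
    and H G :: "('a \<times> 'a) set"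
    and I :: "'a set set"
    and A :: "'a set"
  assumes "group \<Gamma>" and "countable (carrier \<Gamma>)"
    and "polish_space_top X"
    and "continuous_action \<Gamma> X \<phi>"
    and "free_action \<Gamma> (topspace X) \<phi>"
    and "graph_on (topspace X) H"
    and "openin (prod_topology X X) H"
    and "invariant_rel \<Gamma> \<phi> H"
    and "G = H \<inter> orbit_equivalence \<Gamma> (topspace X) \<phi>"
    and "I = sigma_ideal_generated (topspace X)
               {B \<in> borel_sets_of X. anticlique (topspace X) G B}"
    and "A \<subseteq> topspace X" and "analytic_in X A"
  shows "(A \<in> I \<or>
            (\<exists>f :: (nat \<Rightarrow> bool) \<Rightarrow> 'a.
              continuous_map euclidean (subtopology X A) f \<and> inj f \<and>
              reduction_on UNIV vitali_graph G f)) \<and>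
         \<not> (A \<in> I \<and>
            (\<exists>f :: (nat \<Rightarrow> bool) \<Rightarrow> 'a.
              continuous_map euclidean (subtopology X A) f \<and> inj f \<and>
              reduction_on UNIV vitali_graph G f))"
proof -
  interpret L: open_graph_action \<Gamma> X \<phi> H
    using assms(1-8) by (rule open_graph_action.intro)
  have I: "A \<in> I \<longleftrightarrow> L.null A"
    unfolding assms(9,10) ..
  have "\<exists>f :: (nat \<Rightarrow> bool) \<Rightarrow> 'a. continuous_map euclidean (subtopology X A) f \<and> inj f \<and>
      reduction_on UNIV vitali_graph G f" if "\<not> L.null A"
  proof -
    have "L.null {}"
      unfolding L.null_iff by blast
    \<comment> \<open>The definition of analytic sets supplies a parametrization by the Baire space
      only when the set is nonempty.\<close>
    then have "A \<noteq> {}"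
      using that by auto
    then obtain p where p: "continuous_map (euclidean :: (nat \<Rightarrow> nat) topology) X p" "A = range p"
      using assms(12) unfolding analytic_in_def by blast
    obtain e :: "nat \<Rightarrow> 'g" where e: "range e = carrier \<Gamma>"
      using range_from_nat_into[OF _ assms(2)] L.one_closed by blast
    interpret fusion \<Gamma> X \<phi> H p e
      by unfold_locales (use p e that in auto)
    show ?thesis
      using continuous_reduction_exists unfolding assms(9) p(2) .
  qed
  moreover have False
    if null: "L.null A" and f: "continuous_map euclidean (subtopology X A) f"
      and red: "reduction_on UNIV vitali_graph G f" for f :: "(nat \<Rightarrow> bool) \<Rightarrow> 'a"
  proof -
    obtain \<C> where \<C>: "countable \<C>" "\<C> \<subseteq> {B \<in> borel_sets_of X. anticlique (topspace X) L.G B}" "A \<subseteq> \<Union>\<C>"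
      using null unfolding L.null_iff by blast
    have fX: "continuous_map euclidean X f" and fA: "range f \<subseteq> A"
      using f by (auto simp: continuous_map_in_subtopology)
    have "\<C> \<noteq> {}"
      using fA \<C>(3) by auto
    \<comment> \<open>Preimages of the covering Borel anticliques cover the Cantor space and have
      the Baire property, so one of them contains a Vitali edge, which \<open>f\<close> carries to a
      \<open>G\<close>-edge inside an anticlique.\<close>
    define B where "B n = f -` from_nat_into \<C> n" for n
    have "(\<Union>n. B n) = f -` \<Union>(range (from_nat_into \<C>))"
      by (auto simp: B_def)
    also have "\<dots> = UNIV"
      unfolding range_from_nat_into[OF \<open>\<C> \<noteq> {}\<close> \<C>(1)] using fA \<C>(3)
      by (simp only: vimage_def image_subset_iff) blast
    finally have "(\<Union>n. B n) = UNIV" .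
    have in_\<C>: "from_nat_into \<C> n \<in> \<C>" for n
      using \<open>\<C> \<noteq> {}\<close> by (rule from_nat_into)
    have "baire_property (B n)" for n
      unfolding B_def using \<C>(2) in_\<C>[of n] by (intro baire_property_vimage[OF fX]) auto
    with \<open>(\<Union>n. B n) = UNIV\<close> obtain n x y
      where xy: "x \<in> B n" "y \<in> B n" "(x, y) \<in> vitali_graph"
      using vitali_graph_no_countable_cover[of B] by auto
    then have "(f x, f y) \<in> L.G"
      using red assms(9) unfolding reduction_on_def by blast
    moreover have "anticlique (topspace X) L.G (from_nat_into \<C> n)"
      using in_\<C>[of n] \<C>(2) by blast
    ultimately show False
      using xy(1,2) unfolding anticlique_def B_def by blast
  qed
  ultimately show ?thesis
    unfolding I by blast
qed

end
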